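(* Let $X=\ell_2$ (complex sequences indexed by $\mathbb Z_+$), with canonical basis $(e_j)_{j\ge0}$, and let $$\mathcal T_1(X)=\bigl\{T\in\mathcal B_1(X):\ Te_j\in[e_0,\dots,e_{j+1}]\ \text{and}\ \langle Te_j,e_{j+1}\rangle>0\ \text{for every } j\ge0\bigr\}.$$ A typical $T\in(\mathcal T_1(X),\mathrm{SOT})$ is unitarily equivalent to the backward shift of infinite multiplicity $B_\infty$ acting on $\ell_2(\mathbb Z_+,\ell_2)$. In particular, a typical $T\in(\mathcal T_1(X),\mathrm{SOT})$ has eigenvalues, and hence non-trivial invariant subspaces.
   Context: $\mathcal B_1(X)$ is the set of all bounded linear operators $T$ on $X$ with $\|T\|\le 1$; $[\,\cdot\,]$ denotes (closed) linear span. SOT (Strong Operator Topology) is the topology of pointwise norm convergence on $X$; $\mathcal T_1(X)$ is a $G_\delta$ subset of the Polish space $(\mathcal B_1(X),\mathrm{SOT})$, hence $(\mathcal T_1(X),\mathrm{SOT})$ is a Polish space. "A typical $T\in(\mathcal T_1(X),\mathrm{SOT})$ satisfies (P)" means that the set of $T\in\mathcal T_1(X)$ satisfying (P) is comeager in $(\mathcal T_1(X),\mathrm{SOT})$. The operator $B_\infty$ on $\ell_2(\mathbb Z_+,\ell_2)$ (the $\ell_2$-direct sum of countably many copies of $\ell_2$) is $B_\infty(x_0,x_1,x_2,\dots)=(x_1,x_2,x_3,\dots)$. A non-trivial invariant subspace of $T$ is a closed linear subspace $E\subseteq X$ with $E\ne\{0\}$, $E\neq X$ and $T(E)\subseteq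 E$. *)

theory Defs
  imports "HOL-Analysis.Analysis"
begin

section \<open>Complex inner product spaces\<close>

text \<open>The library has real inner product spaces only.  The class below adds a complex scalar
  multiplication and a complex inner product, linear in the \<^emph>\<open>first\<close> argument, whose real part
  is the given real inner product; hence the norm is the one induced by \<open>cinner\<close>.
  Complex spans, subspaces and linear maps are the library notions for arbitrary scalars, at
  \<open>scaleC\<close>: \<open>module.span scaleC\<close>, \<open>module.subspace scaleC\<close> and
  \<open>Vector_Spaces.linear scaleC scaleC\<close>.\<close>

class complex_inner = real_inner +
  fixes scaleC :: "complex \<Rightarrow> 'a \<Rightarrow> 'a" (infixr \<open>*\<^sub>C\<close> 75)
    and cinner :: "'a \<Rightarrow> 'a \<Rightarrow> complex"
  assumes scaleC_add_right: "a *\<^sub>C (x + y) = a *\<^sub>C x + a *\<^sub>C y"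
    and scaleC_add_left: "(a + b) *\<^sub>C x = a *\<^sub>C x + b *\<^sub>C x"
    and scaleC_scaleC: "a *\<^sub>C (b *\<^sub>C x) = (a * b) *\<^sub>C x"
    and scaleR_scaleC: "r *\<^sub>R x = complex_of_real r *\<^sub>C x"
    and cinner_commute: "cinner x y = cnj (cinner y x)"
    and cinner_add_left: "cinner (x + y) z = cinner x z + cinner y z"
    and cinner_scaleC_left: "cinner (a *\<^sub>C x) y = a * cinner x y"
    and Re_cinner: "Re (cinner x y) = inner x y"

lemma scaleC_one: "1 *\<^sub>C x = x"
  using scaleR_scaleC[of 1 x] by simp

lemma vector_space_scaleC: "vector_space (scaleC :: complex \<Rightarrow> 'a \<Rightarrow> 'a::complex_inner)"
  by unfold_locales (simp_all add: scaleC_add_right scaleC_add_left scaleC_scaleC scaleC_one)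

lemma cinner_same: "cinner x x = complex_of_real ((norm x)\<^sup>2)"
proof (rule complex_eqI)
  show "Re (cinner x x) = Re (complex_of_real ((norm x)\<^sup>2))"
    by (simp add: Re_cinner power2_norm_eq_inner)
  have "Im (cinner x x) = - Im (cinner x x)"
    by (subst cinner_commute) simp
  then show "Im (cinner x x) = Im (complex_of_real ((norm x)\<^sup>2))" by simp
qed

lemma cinner_scaleC_right: "cinner x (a *\<^sub>C y) = cnj a * cinner x y"
  by (metis cinner_commute cinner_scaleC_left complex_cnj_mult)

lemma norm_scaleC: "norm (a *\<^sub>C x) = cmod a * norm x"
proof -
  have "cinner (a *\<^sub>C x) (a *\<^sub>C x) = (a * cnj a) * cinner x x"
    by (simp add: cinner_scaleC_left cinner_scaleC_right mult.assoc)
  then have "complex_of_real ((norm (a *\<^sub>C x))\<^sup>2) = complex_of_real ((cmod a * norm x)\<^sup>2)"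
    by (simp only: cinner_same complex_norm_square[symmetric] power_mult_distrib of_real_mult)
  then have "(norm (a *\<^sub>C x))\<^sup>2 = (cmod a * norm x)\<^sup>2"
    by (simp only: of_real_eq_iff)
  then show ?thesis
    by (simp add: power2_eq_iff_nonneg)
qed

lemma norm_cinner_le: "cmod (cinner x y) \<le> norm x * norm y"
proof (cases "cinner x y = 0")
  case False
  define c where "c = cnj (cinner x y) / cmod (cinner x y)"
  have c: "cmod c = 1" using False by (simp add: c_def norm_divide)
  have "c * cinner x y = complex_of_real (cmod (cinner x y))"
    using False by (simp add: c_def mult.commute[of "cnj _"] complex_norm_square[symmetric]
        power2_eq_square)
  then have "cmod (cinner x y) = Re (cinner (c *\<^sub>C x) y)"
    by (simp add: cinner_scaleC_left)
  also have "\<dots> \<le> norm (c *\<^sub>C x) * norm y"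
    unfolding Re_cinner by (rule norm_cauchy_schwarz)
  finally show ?thesis by (simp add: norm_scaleC c)
qed simp

instantiation complex :: complex_inner
begin
definition scaleC_complex :: "complex \<Rightarrow> complex \<Rightarrow> complex" where
  "scaleC_complex a x = a * x"
definition cinner_complex :: "complex \<Rightarrow> complex \<Rightarrow> complex" where
  "cinner_complex x y = x * cnj y"
instance
  by standard
    (simp_all add: scaleC_complex_def cinner_complex_def algebra_simps scaleR_conv_of_real
      inner_complex_def)
end


section \<open>The Hilbert space of square-summable sequences\<close>

text \<open>\<open>'a ell2\<close> is the space of square-summable sequences in \<open>'a\<close>: \<open>complex ell2\<close> is
  $\ell_2$ and \<open>complex ell2 ell2\<close> is $\ell_2(Z_+, \ell_2)$.\<close>

typedef (overloaded) 'a ell2 = "{x :: nat \<Rightarrow> 'a::real_inner. summable (\<lambda>n. (norm (x n))\<^sup>2)}"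
  morphisms ell2_nth Abs_ell2
  by (rule exI[of _ "\<lambda>_. 0"]) simp

setup_lifting type_definition_ell2

lemma summable_ell2: "summable (\<lambda>n. (norm (ell2_nth x n))\<^sup>2)"
  using ell2_nth[of x] by simp

lemma summable_norm_mult_ell2: "summable (\<lambda>n. norm (ell2_nth x n) * norm (ell2_nth y n))"
proof (rule summable_comparison_test'[where N = 0])
  show "summable (\<lambda>n. (norm (ell2_nth x n))\<^sup>2 + (norm (ell2_nth y n))\<^sup>2)"
    by (intro summable_add summable_ell2)
  fix n
  have "2 * (norm (ell2_nth x n) * norm (ell2_nth y n))
      \<le> (norm (ell2_nth x n))\<^sup>2 + (norm (ell2_nth y n))\<^sup>2"
    using sum_squares_bound[of "norm (ell2_nth x n)" "norm (ell2_nth y n)"]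
    by (simp add: mult.assoc)
  moreover have "0 \<le> norm (ell2_nth x n) * norm (ell2_nth y n)" by simp
  ultimately show "norm (norm (ell2_nth x n) * norm (ell2_nth y n))
      \<le> (norm (ell2_nth x n))\<^sup>2 + (norm (ell2_nth y n))\<^sup>2"
    unfolding real_norm_def by linarith
qed

lemma summable_inner_ell2: "summable (\<lambda>n. inner (ell2_nth x n) (ell2_nth y n))"
  by (rule summable_comparison_test'[where N = 0, OF summable_norm_mult_ell2[of x y]])
    (simp add: Cauchy_Schwarz_ineq2)

lemma summable_cinner_ell2: "summable (\<lambda>n. cinner (ell2_nth x n) (ell2_nth y n))"
  by (rule summable_comparison_test'[where N = 0, OF summable_norm_mult_ell2[of x y]])
    (simp add: norm_cinner_le)

instantiation ell2 :: (real_inner) real_inner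
begin

lift_definition zero_ell2 :: "'a ell2" is "\<lambda>_. 0" by simp

lift_definition uminus_ell2 :: "'a ell2 \<Rightarrow> 'a ell2" is "\<lambda>x n. - x n" by simp

lift_definition plus_ell2 :: "'a ell2 \<Rightarrow> 'a ell2 \<Rightarrow> 'a ell2" is "\<lambda>x y n. x n + y n"
proof -
  fix x y :: "nat \<Rightarrow> 'a"
  assume x: "summable (\<lambda>n. (norm (x n))\<^sup>2)" and y: "summable (\<lambda>n. (norm (y n))\<^sup>2)"
  show "summable (\<lambda>n. (norm (x n + y n))\<^sup>2)"
  proof (rule summable_comparison_test'[where N = 0])
    show "summable (\<lambda>n. 2 * ((norm (x n))\<^sup>2 + (norm (y n))\<^sup>2))"
      by (intro summable_mult summable_add x y)
    fix n
    have "(norm (x n + y n))\<^sup>2 \<le> (norm (x n) + norm (y n))\<^sup>2"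
      by (intro power_mono norm_triangle_ineq) simp
    also have "\<dots> \<le> 2 * ((norm (x n))\<^sup>2 + (norm (y n))\<^sup>2)"
      using sum_squares_bound[of "norm (x n)" "norm (y n)"]
      by (simp add: power2_sum)
    finally show "norm ((norm (x n + y n))\<^sup>2) \<le> 2 * ((norm (x n))\<^sup>2 + (norm (y n))\<^sup>2)"
      by simp
  qed
qed

definition minus_ell2 :: "'a ell2 \<Rightarrow> 'a ell2 \<Rightarrow> 'a ell2" where
  "minus_ell2 x y = x + - y"

lift_definition scaleR_ell2 :: "real \<Rightarrow> 'a ell2 \<Rightarrow> 'a ell2" is "\<lambda>r x n. r *\<^sub>R x n"
  by (simp add: power_mult_distrib)

definition inner_ell2 :: "'a ell2 \<Rightarrow> 'a ell2 \<Rightarrow> real" where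
  "inner_ell2 x y = (\<Sum>n. inner (ell2_nth x n) (ell2_nth y n))"

definition norm_ell2 :: "'a ell2 \<Rightarrow> real" where
  "norm_ell2 x = sqrt (\<Sum>n. (norm (ell2_nth x n))\<^sup>2)"

definition dist_ell2 :: "'a ell2 \<Rightarrow> 'a ell2 \<Rightarrow> real" where
  "dist_ell2 x y = norm (x - y)"

definition sgn_ell2 :: "'a ell2 \<Rightarrow> 'a ell2" where
  "sgn_ell2 x = inverse (norm x) *\<^sub>R x"

definition uniformity_ell2 :: "('a ell2 \<times> 'a ell2) filter" where
  "uniformity_ell2 = (INF e\<in>{0<..}. principal {(x, y). dist x y < e})"

definition open_ell2 :: "'a ell2 set \<Rightarrow> bool" where
  "open_ell2 U \<longleftrightarrow> (\<forall>x\<in>U. \<forall>\<^sub>F (x', y) in uniformity. x' = x \<longrightarrow> y \<in> U)"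

instance
proof
  fix x y z :: "'a ell2" and r s :: real
  show "x + y + z = x + (y + z)" by transfer (simp add: add.assoc)
  show "x + y = y + x" by transfer (simp add: add.commute)
  show "0 + x = x" by transfer simp
  show "- x + x = 0" by transfer simp
  show "x - y = x + - y" by (rule minus_ell2_def)
  show "r *\<^sub>R (x + y) = r *\<^sub>R x + r *\<^sub>R y" by transfer (simp add: scaleR_add_right)
  show "(r + s) *\<^sub>R x = r *\<^sub>R x + s *\<^sub>R x" by transfer (simp add: scaleR_add_left)
  show "r *\<^sub>R s *\<^sub>R x = (r * s) *\<^sub>R x" by transfer simp
  show "1 *\<^sub>R x = x" by transfer simp
  show "dist x y = norm (x - y)" by (rule dist_ell2_def)
  show "sgn x = inverse (norm x) *\<^sub>R x" by (rule sgn_ell2_def)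
  show "uniformity = (INF e\<in>{0<..}. principal {(x :: 'a ell2, y). dist x y < e})"
    by (rule uniformity_ell2_def)
  show "open U \<longleftrightarrow> (\<forall>x\<in>U. \<forall>\<^sub>F (x', y) in uniformity. x' = x \<longrightarrow> y \<in> U)" for U :: "'a ell2 set"
    by (rule open_ell2_def)
  show "inner x y = inner y x" by (simp add: inner_ell2_def inner_commute)
  show "inner (x + y) z = inner x z + inner y z"
    by (simp add: inner_ell2_def plus_ell2.rep_eq inner_add_left suminf_add summable_inner_ell2)
  show "inner (r *\<^sub>R x) y = r * inner x y"
    by (simp add: inner_ell2_def scaleR_ell2.rep_eq suminf_mult summable_inner_ell2)
  show "0 \<le> inner x x"
    by (simp add: inner_ell2_def suminf_nonneg summable_inner_ell2)
  show "inner x x = 0 \<longleftrightarrow> x = 0"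
  proof -
    have "inner x x = 0 \<longleftrightarrow> (\<forall>n. inner (ell2_nth x n) (ell2_nth x n) = 0)"
      unfolding inner_ell2_def by (rule suminf_eq_zero_iff) (simp_all add: summable_inner_ell2)
    also have "\<dots> \<longleftrightarrow> x = 0"
      by (simp add: ell2_nth_inject[symmetric] zero_ell2.rep_eq fun_eq_iff)
    finally show ?thesis .
  qed
  show "norm x = sqrt (inner x x)"
    by (simp add: norm_ell2_def inner_ell2_def power2_norm_eq_inner)
qed

end

instantiation ell2 :: (complex_inner) complex_inner
begin

lift_definition scaleC_ell2 :: "complex \<Rightarrow> 'a ell2 \<Rightarrow> 'a ell2" is "\<lambda>a x n. a *\<^sub>C x n"
  by (simp add: norm_scaleC power_mult_distrib)

definition cinner_ell2 :: "'a ell2 \<Rightarrow> 'a ell2 \<Rightarrow> complex" where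
  "cinner_ell2 x y = (\<Sum>n. cinner (ell2_nth x n) (ell2_nth y n))"

instance
proof
  fix x y z :: "'a ell2" and a b :: complex and r :: real
  show "a *\<^sub>C (x + y) = a *\<^sub>C x + a *\<^sub>C y" by transfer (simp add: scaleC_add_right)
  show "(a + b) *\<^sub>C x = a *\<^sub>C x + b *\<^sub>C x" by transfer (simp add: scaleC_add_left)
  show "a *\<^sub>C b *\<^sub>C x = (a * b) *\<^sub>C x" by transfer (simp add: scaleC_scaleC)
  show "r *\<^sub>R x = complex_of_real r *\<^sub>C x" by transfer (simp add: scaleR_scaleC)
  have "(\<lambda>n. cnj (cinner (ell2_nth y n) (ell2_nth x n))) sums cnj (cinner y x)"
    unfolding cinner_ell2_def
    by (subst sums_cnj) (rule summable_sums[OF summable_cinner_ell2])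
  then show "cinner x y = cnj (cinner y x)"
    unfolding cinner_commute[of "ell2_nth y _", symmetric]
    by (simp add: cinner_ell2_def[of x y] cinner_commute[symmetric] sums_iff)
  show "cinner (x + y) z = cinner x z + cinner y z"
    by (simp add: cinner_ell2_def plus_ell2.rep_eq cinner_add_left suminf_add summable_cinner_ell2)
  show "cinner (a *\<^sub>C x) y = a * cinner x y"
    by (simp add: cinner_ell2_def scaleC_ell2.rep_eq cinner_scaleC_left suminf_mult
        summable_cinner_ell2)
  have "(\<lambda>n. Re (cinner (ell2_nth x n) (ell2_nth y n))) sums Re (cinner x y)"
    unfolding cinner_ell2_def by (rule sums_Re[OF summable_sums[OF summable_cinner_ell2]])
  then show "Re (cinner x y) = inner x y"
    by (simp add: inner_ell2_def Re_cinner sums_iff)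
qed

end

lift_definition basis_ell2 :: "nat \<Rightarrow> complex ell2" is "\<lambda>j n. if n = j then 1 else 0"
  by (rule summable_finite[where N = "{j}" for j]) auto

text \<open>For \<open>'a = complex ell2\<close> this is the backward shift of infinite multiplicity.\<close>

lift_definition backward_shift :: "'a::real_inner ell2 \<Rightarrow> 'a ell2" is "\<lambda>x n. x (Suc n)"
  by (simp add: summable_Suc_iff[where f = "\<lambda>n. (norm (_ n))\<^sup>2"])


section \<open>Operators\<close>

definition unitarily_equivalent ::
  "('a::complex_inner \<Rightarrow> 'a) \<Rightarrow> ('b::complex_inner \<Rightarrow> 'b) \<Rightarrow> bool" where
  "unitarily_equivalent T S \<longleftrightarrow>
     (\<exists>U :: 'a \<Rightarrow> 'b. Vector_Spaces.linear scaleC scaleC U \<and> bij U \<and>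
        (\<forall>x y. cinner (U x) (U y) = cinner x y) \<and> (\<forall>x. U (T x) = S (U x)))"

definition eigenvalue :: "('a::complex_inner \<Rightarrow> 'a) \<Rightarrow> complex \<Rightarrow> bool" where
  "eigenvalue T c \<longleftrightarrow> (\<exists>x. x \<noteq> 0 \<and> T x = c *\<^sub>C x)"

definition nontrivial_invariant_subspace ::
  "('a::complex_inner \<Rightarrow> 'a) \<Rightarrow> 'a set \<Rightarrow> bool" where
  "nontrivial_invariant_subspace T E \<longleftrightarrow>
     module.subspace scaleC E \<and> closed E \<and> E \<noteq> {0} \<and> E \<noteq> UNIV \<and> T ` E \<subseteq> E"

text \<open>The type \<open>'a \<Rightarrow>\<^sub>L 'a\<close> consists of the bounded \<^emph>\<open>real\<close>-linear operators, so
  complex linearity is imposed separately.\<close>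

definition contractions :: "('a::complex_inner \<Rightarrow>\<^sub>L 'a) set" where
  "contractions = {T. Vector_Spaces.linear scaleC scaleC (blinfun_apply T) \<and> norm T \<le> 1}"

text \<open>A complex number is positive if it is real with positive real part.\<close>

definition T1 :: "(complex ell2 \<Rightarrow>\<^sub>L complex ell2) set" where
  "T1 = {T \<in> contractions. \<forall>j.
     blinfun_apply T (basis_ell2 j) \<in> closure (module.span scaleC (basis_ell2 ` {..Suc j})) \<and>
     cinner (blinfun_apply T (basis_ell2 j)) (basis_ell2 (Suc j)) \<in> \<real> \<and>
     Re (cinner (blinfun_apply T (basis_ell2 j)) (basis_ell2 (Suc j))) > 0}"


section \<open>Baire category\<close>

definition nowhere_dense_in :: "'a topology \<Rightarrow> 'a set \<Rightarrow> bool" where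
  "nowhere_dense_in X A \<longleftrightarrow> A \<subseteq> topspace X \<and> X interior_of (X closure_of A) = {}"

definition meager_in :: "'a topology \<Rightarrow> 'a set \<Rightarrow> bool" where
  "meager_in X A \<longleftrightarrow> (\<exists>N :: nat \<Rightarrow> 'a set. (\<forall>n. nowhere_dense_in X (N n)) \<and> A = (\<Union>n. N n))"

definition comeager_in :: "'a topology \<Rightarrow> 'a set \<Rightarrow> bool" where
  "comeager_in X A \<longleftrightarrow> A \<subseteq> topspace X \<and> meager_in X (topspace X - A)"

definition typical_in :: "'a topology \<Rightarrow> ('a \<Rightarrow> bool) \<Rightarrow> bool" where
  "typical_in X P \<longleftrightarrow> comeager_in X {x \<in> topspace X. P x}"

end

theory Submission
  imports Defs
begin

text \<open>Let $T$ be a contraction with $TT^* = I$ and $T^n \to 0$ strongly, let $K = \ker T$ and let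
  $W$ be the coordinate map of $K$ composed with the projection onto $K$.  Then
  $\|x\|^2 = \|Wx\|^2 + \|Tx\|^2$, which telescopes to show that $x \mapsto (W T^n x)_n$ is an
  isometry; it intertwines $T$ with the backward shift, and $T^*$ provides preimages.
  If moreover $\|Tv\| < \|v\|$ for all finitely supported $v \ne 0$, then the projections of the
  $e_j$ onto $K$ are linearly independent, so $K$ is infinite-dimensional and an orthonormal
  basis of it is obtained by Gram--Schmidt.

  Each of the three conditions on $T$ is a countable intersection of SOT-open conditions.
  For two of them density is immediate, since $rT$ with $r < 1$ satisfies them.  For $TT^* = I$
  it suffices that each $e_i$ is approximated by images of vectors of the unit ball: cut $T$ down
  to finitely many basis vectors, send one further basis vector to a suitable multiple of the
  defect $e_i - TT^*e_i$, and restore positivity of the subdiagonal with a small multiple of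
  a shift.  As density is shown for each open set separately, the Baire category theorem is not
  needed.\<close>

section \<open>Complex inner product spaces\<close>

interpretation scaleC: vector_space "scaleC :: complex \<Rightarrow> 'a \<Rightarrow> 'a::complex_inner"
  by (rule vector_space_scaleC)

lemma clinear_iff:
  "Vector_Spaces.linear scaleC scaleC (f :: 'a::complex_inner \<Rightarrow> 'b::complex_inner) \<longleftrightarrow>
     (\<forall>x y. f (x + y) = f x + f y) \<and> (\<forall>c x. f (c *\<^sub>C x) = c *\<^sub>C f x)"
  by (simp add: Vector_Spaces.linear_iff vector_space_scaleC)

lemma cinner_add_right: "cinner x (y + z) = cinner x y + cinner x z"
  by (metis cinner_commute cinner_add_left complex_cnj_add)

lemma cinner_zero_left [simp]: "cinner 0 y = 0"
  using cinner_scaleC_left[of 0 0 y] by simp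

lemma cinner_zero_right [simp]: "cinner x 0 = 0"
  using cinner_scaleC_right[of x 0 0] by simp

lemma cinner_diff_left: "cinner (x - y) z = cinner x z - cinner y z"
  using cinner_add_left[of "x - y" y z] by simp

lemma cinner_sum_left: "cinner (\<Sum>i\<in>A. f i) y = (\<Sum>i\<in>A. cinner (f i) y)"
  by (induction A rule: infinite_finite_induct) (simp_all add: cinner_add_left)

lemma cinner_eq_zero_commute: "cinner x y = 0 \<longleftrightarrow> cinner y x = 0"
  by (metis cinner_commute complex_cnj_zero)

lemma bounded_linear_cinner_left: "bounded_linear (\<lambda>x :: 'a::complex_inner. cinner x y)"
  by (rule bounded_linear_intro[where K = "norm y"])
    (simp_all add: cinner_add_left scaleR_scaleC[of _ "_ :: 'a"] cinner_scaleC_left norm_cinner_le scaleR_conv_of_real)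

lemma norm_add_orthogonal:
  assumes "cinner x y = 0"
  shows "(norm (x + y))\<^sup>2 = (norm x)\<^sup>2 + (norm y)\<^sup>2"
proof -
  have "inner x y = 0" using assms by (simp flip: Re_cinner)
  then show ?thesis by (simp add: power2_norm_eq_inner inner_add_left inner_add_right inner_commute)
qed

text \<open>Polarisation gives the real parts. The imaginary part of a complex number is the real
  part of its product with \<open>- \<i>\<close>, so the imaginary parts follow on replacing
  \<open>x\<close> by its multiple by \<open>- \<i>\<close>.\<close>

lemma cinner_isometry:
  fixes U :: "'a::complex_inner \<Rightarrow> 'b::complex_inner"
  assumes lin: "Vector_Spaces.linear scaleC scaleC U" and iso: "\<And>x. norm (U x) = norm x"
  shows "cinner (U x) (U y) = cinner x y"
proof -
  interpret U: Vector_Spaces.linear scaleC scaleC U by fact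
  have inner: "inner (U x) (U y) = inner x y" for x y
  proof -
    have sq: "inner (U z) (U z) = inner z z" for z
      by (simp add: iso flip: power2_norm_eq_inner)
    show ?thesis
      using sq[of "x + y"] sq[of x] sq[of y]
      by (simp add: U.add inner_add_left inner_add_right inner_commute)
  qed
  have "Re (cinner (U x) (U y)) = Re (cinner x y)" by (simp add: Re_cinner inner)
  moreover have "Re (cinner (U (- \<i> *\<^sub>C x)) (U y)) = Re (cinner (- \<i> *\<^sub>C x) y)"
    by (simp only: Re_cinner inner)
  then have "Im (cinner (U x) (U y)) = Im (cinner x y)"
    by (simp only: U.scale cinner_scaleC_left) simp
  ultimately show ?thesis by (rule complex_eqI)
qed

lemma bounded_linear_contraction:
  assumes "Vector_Spaces.linear scaleC scaleC (f :: 'a::complex_inner \<Rightarrow> 'b::complex_inner)"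
    and "\<And>x. norm (f x) \<le> norm x"
  shows "bounded_linear f"
  using assms by (intro bounded_linear_intro[where K = 1]) (simp_all add: clinear_iff scaleR_scaleC)

section \<open>Orthonormal sequences\<close>

lemma norm_eq_1_cinner: "cinner x x = 1 \<Longrightarrow> norm x = 1"
  by (simp add: cinner_same norm_eq_1 power2_norm_eq_inner flip: of_real_power)

definition orthonormal :: "(nat \<Rightarrow> 'a::complex_inner) \<Rightarrow> bool" where
  "orthonormal f \<longleftrightarrow> (\<forall>m n. cinner (f m) (f n) = (if m = n then 1 else 0))"

lemma norm_orthonormal: "orthonormal f \<Longrightarrow> norm (f k) = 1"
  by (rule norm_eq_1_cinner) (simp add: orthonormal_def)

lemma cinner_zero_on_span:
  assumes "\<And>y. y \<in> S \<Longrightarrow> cinner x y = 0" and "y \<in> scaleC.span S"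
  shows "cinner x y = 0"
  using assms(2)
  by (induction rule: scaleC.span_induct_alt) (simp_all add: cinner_add_right cinner_scaleC_right assms(1))

lemma orthonormal_projection:
  fixes f :: "nat \<Rightarrow> 'a::complex_inner"
  assumes "orthonormal f" and "y \<in> scaleC.span (f ` {..<n})"
  shows "cinner (x - (\<Sum>k<n. cinner x (f k) *\<^sub>C f k)) y = 0"
proof (rule cinner_zero_on_span[OF _ assms(2)])
  fix y assume "y \<in> f ` {..<n}"
  then obtain m where m: "m < n" "y = f m" by auto
  have "(\<Sum>k<n. cinner x (f k) * cinner (f k) (f m)) = (\<Sum>k<n. if k = m then cinner x (f k) else 0)"
    by (rule sum.cong) (use assms(1) in \<open>auto simp: orthonormal_def\<close>)
  then show "cinner (x - (\<Sum>k<n. cinner x (f k) *\<^sub>C f k)) y = 0"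
    using m by (simp add: cinner_diff_left cinner_sum_left cinner_scaleC_left)
qed

lemma norm_sum_orthonormal:
  assumes "orthonormal (f :: nat \<Rightarrow> 'a::complex_inner)"
  shows "(norm (\<Sum>k<n. c k *\<^sub>C f k))\<^sup>2 = (\<Sum>k<n. (cmod (c k))\<^sup>2)"
proof (induction n)
  case (Suc n)
  have "cinner (\<Sum>k<n. c k *\<^sub>C f k) (c n *\<^sub>C f n) = 0"
    using assms by (simp add: cinner_sum_left cinner_scaleC_left cinner_scaleC_right orthonormal_def)
  then show ?case
    by (simp add: norm_add_orthogonal Suc.IH norm_scaleC norm_orthonormal[OF assms])
qed simp

text \<open>The orthogonal projection \<open>p\<close> of \<open>x\<close> onto the span is its
  nearest point: Pythagoras splits \<open>x\<close> at \<open>p\<close>, and splits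
  \<open>x - s\<close> into the orthogonal parts \<open>x - p\<close> and
  \<open>p - s\<close>.\<close>

lemma best_approximation:
  fixes f :: "nat \<Rightarrow> 'a::complex_inner"
  assumes f: "orthonormal f" and s: "s \<in> scaleC.span (f ` {..<n})"
  shows "(norm x)\<^sup>2 \<le> (\<Sum>k<n. (cmod (cinner x (f k)))\<^sup>2) + (norm (x - s))\<^sup>2"
proof -
  define p where "p = (\<Sum>k<n. cinner x (f k) *\<^sub>C f k)"
  have p: "p \<in> scaleC.span (f ` {..<n})"
    unfolding p_def by (intro scaleC.span_sum scaleC.span_scale scaleC.span_base) auto
  have "(norm ((x - p) + p))\<^sup>2 = (norm (x - p))\<^sup>2 + (norm p)\<^sup>2"
    unfolding p_def by (intro norm_add_orthogonal orthonormal_projection[OF f p[unfolded p_def]])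
  moreover have "(norm ((x - p) + (p - s)))\<^sup>2 = (norm (x - p))\<^sup>2 + (norm (p - s))\<^sup>2"
    by (intro norm_add_orthogonal)
      (use orthonormal_projection[OF f scaleC.span_diff[OF p s], of x] in \<open>simp add: p_def\<close>)
  ultimately show ?thesis
    using norm_sum_orthonormal[OF f, of "\<lambda>k. cinner x (f k)" n] zero_le_power2[of "norm (p - s)"]
    by (simp add: p_def del: zero_le_power2)
qed

lemma bessel:
  fixes f :: "nat \<Rightarrow> 'a::complex_inner"
  assumes f: "orthonormal f"
  shows "(\<Sum>k<n. (cmod (cinner x (f k)))\<^sup>2) \<le> (norm x)\<^sup>2"
proof -
  define p where "p = (\<Sum>k<n. cinner x (f k) *\<^sub>C f k)"
  have p: "p \<in> scaleC.span (f ` {..<n})"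
    unfolding p_def by (intro scaleC.span_sum scaleC.span_scale scaleC.span_base) auto
  have "(norm ((x - p) + p))\<^sup>2 = (norm (x - p))\<^sup>2 + (norm p)\<^sup>2"
    unfolding p_def by (intro norm_add_orthogonal orthonormal_projection[OF f p[unfolded p_def]])
  then show ?thesis
    using norm_sum_orthonormal[OF f, of "\<lambda>k. cinner x (f k)" n] by (simp add: p_def)
qed

lemma summable_bessel:
  assumes "orthonormal f"
  shows "summable (\<lambda>k. (cmod (cinner x (f k)))\<^sup>2)"
  by (rule summableI_nonneg_bounded[OF _ bessel[OF assms]]) simp

text \<open>Bessel gives one inequality. For the other, \<open>approx\<close> places
  \<open>x\<close> in the closed span of \<open>f\<close>, and best approximation bounds the missing
  part of the squared norm by every \<open>e > 0\<close>.\<close>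

lemma parseval:
  fixes f :: "nat \<Rightarrow> 'a::complex_inner"
  assumes f: "orthonormal f"
    and approx: "\<And>e. e > 0 \<Longrightarrow> \<exists>n. \<exists>s\<in>scaleC.span (f ` {..<n}). norm (x - s) < e"
  shows "(\<lambda>k. (cmod (cinner x (f k)))\<^sup>2) sums (norm x)\<^sup>2"
proof -
  let ?a = "\<lambda>k. (cmod (cinner x (f k)))\<^sup>2"
  have "(norm x)\<^sup>2 \<le> suminf ?a + e" if "e > 0" for e
  proof -
    obtain n s where s: "s \<in> scaleC.span (f ` {..<n})" "norm (x - s) < sqrt e"
      using approx[of "sqrt e"] \<open>e > 0\<close> by auto
    have "(norm (x - s))\<^sup>2 \<le> e"
      using s(2) \<open>e > 0\<close> by (metis less_imp_le norm_ge_zero power_mono real_sqrt_pow2)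
    then show ?thesis
      using best_approximation[OF f s(1), of x] sum_le_suminf[OF summable_bessel[OF f, of x], of "{..<n}"]
      by simp
  qed
  then have "(norm x)\<^sup>2 \<le> suminf ?a" by (rule field_le_epsilon)
  moreover have "suminf ?a \<le> (norm x)\<^sup>2"
    by (intro suminf_le_const summable_bessel f bessel)
  ultimately show ?thesis
    using summable_bessel[OF f, of x] by (simp add: sums_iff)
qed

text \<open>Equality of the initial spans is carried through the induction together with
  orthonormality: it turns the independence of \<open>g\<close> into non-vanishing of the next
  remainder.\<close>

lemma gram_schmidt:
  fixes g :: "nat \<Rightarrow> 'a::complex_inner"
  assumes indep: "\<And>n. g n \<notin> scaleC.span (g ` {..<n})"
  obtains f where "orthonormal f" "\<And>n. scaleC.span (f ` {..<n}) = scaleC.span (g ` {..<n})"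
proof -
  \<comment> \<open>\<open>step\<close> evaluates \<open>F\<close> only below \<open>n\<close>,
    which is what admissibility for well-founded recursion requires; \<open>sgn\<close> normalises
    the remainder.\<close>
  define step where "step F n = sgn (g n - (\<Sum>k<n. cinner (g n) (F k) *\<^sub>C F k))" for F :: "nat \<Rightarrow> 'a" and n
  define f where "f = wfrec less_than step"
  have "adm_wf less_than step"
    by (auto simp: adm_wf_def step_def intro!: arg_cong[where f = sgn] sum.cong)
  then have f: "f n = sgn (g n - (\<Sum>k<n. cinner (g n) (f k) *\<^sub>C f k))" for n
    unfolding f_def using wfrec_fixpoint[of less_than step] by (metis step_def wf_less_than)
  have "(\<forall>m<n. \<forall>l<n. cinner (f m) (f l) = (if m = l then 1 else 0)) \<and>
      scaleC.span (f ` {..<n}) = scaleC.span (g ` {..<n})" for n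
  proof (induction n)
    case (Suc n)
    define s where "s = (\<Sum>k<n. cinner (g n) (f k) *\<^sub>C f k)"
    have s: "s \<in> scaleC.span (f ` {..<n})"
      unfolding s_def by (intro scaleC.span_sum scaleC.span_scale scaleC.span_base) auto
    have s': "s \<in> scaleC.span (insert z (f ` {..<n}))" for z
      using scaleC.span_mono[of "f ` {..<n}" "insert z (f ` {..<n})"] s by auto
    have "g n - s \<noteq> 0"
      using s Suc.IH indep[of n] by auto
    then obtain r where r: "r \<noteq> 0" "f n = complex_of_real r *\<^sub>C (g n - s)"
      by (metis f s_def sgn_div_norm scaleR_scaleC inverse_nonzero_iff_nonzero norm_eq_zero)
    have "norm (f n) = 1"
      using f[of n] \<open>g n - s \<noteq> 0\<close> by (simp add: s_def norm_sgn)
    then have nn: "cinner (f n) (f n) = 1" by (simp add: cinner_same)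
    have orth: "cinner (f n) (f m) = 0" if "m < n" for m
    proof -
      have "(\<Sum>k<n. cinner (g n) (f k) * cinner (f k) (f m)) = (\<Sum>k<n. if k = m then cinner (g n) (f k) else 0)"
        by (rule sum.cong) (use Suc.IH that in auto)
      then show ?thesis
        using that by (simp add: r(2) cinner_scaleC_left cinner_diff_left s_def cinner_sum_left)
    qed
    have "scaleC.span (insert (f n) (f ` {..<n})) = scaleC.span (insert (g n) (f ` {..<n}))"
    proof (subst scaleC.span_eq, intro conjI insert_subsetI)
      show "f n \<in> scaleC.span (insert (g n) (f ` {..<n}))"
        unfolding r(2) by (intro scaleC.span_scale scaleC.span_diff scaleC.span_base s') auto
      have "g n = complex_of_real (1 / r) *\<^sub>C f n + s"
        using r by (simp add: scaleC_scaleC scaleC_one flip: of_real_mult)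
      also have "\<dots> \<in> scaleC.span (insert (f n) (f ` {..<n}))"
        by (intro scaleC.span_add scaleC.span_scale scaleC.span_base s') auto
      finally show "g n \<in> scaleC.span (insert (f n) (f ` {..<n}))" .
    qed (auto intro: scaleC.span_base)
    also have "\<dots> = scaleC.span (insert (g n) (g ` {..<n}))"
      using Suc.IH unfolding scaleC.span_insert by simp
    finally have "scaleC.span (f ` {..<Suc n}) = scaleC.span (g ` {..<Suc n})"
      by (simp add: lessThan_Suc)
    moreover have "\<forall>m<Suc n. \<forall>l<Suc n. cinner (f m) (f l) = (if m = l then 1 else 0)"
      using Suc.IH nn orth by (auto simp: less_Suc_eq cinner_eq_zero_commute[of "f _" "f n"])
    ultimately show ?case by blast
  qed simp
  \<comment> \<open>Two given indices both lie below the successor of their maximum, so the finite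
    statements cover all pairs.\<close>
  then show ?thesis
    using that[of f] unfolding orthonormal_def by (metis lessI less_Suc_eq_le max.cobounded1 max.cobounded2)
qed

section \<open>Square-summable sequences\<close>

lemma ell2_eqI: "(\<And>n. ell2_nth x n = ell2_nth y n) \<Longrightarrow> x = y"
  by (simp add: ell2_nth_inject[symmetric] fun_eq_iff)

lemma ell2_nth_zero [simp]: "ell2_nth 0 n = 0"
  by (simp add: zero_ell2.rep_eq)

lemma ell2_nth_add [simp]: "ell2_nth (x + y) n = ell2_nth x n + ell2_nth y n"
  by (simp add: plus_ell2.rep_eq)

lemma ell2_nth_diff [simp]: "ell2_nth (x - y) n = ell2_nth x n - ell2_nth y n"
  unfolding minus_ell2_def plus_ell2.rep_eq uminus_ell2.rep_eq by (rule add_uminus_conv_diff)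

lemma ell2_nth_scaleR [simp]: "ell2_nth (r *\<^sub>R x) n = r *\<^sub>R ell2_nth x n"
  by (simp add: scaleR_ell2.rep_eq)

lemma ell2_nth_scaleC [simp]: "ell2_nth (c *\<^sub>C x) n = c *\<^sub>C ell2_nth x n"
  by (simp add: scaleC_ell2.rep_eq)

lemma scaleC_complex [simp]: "c *\<^sub>C z = c * (z :: complex)"
  by (simp add: scaleC_complex_def)

lemma ell2_nth_Abs: "summable (\<lambda>n. (norm (x n))\<^sup>2) \<Longrightarrow> ell2_nth (Abs_ell2 x) = x"
  by (simp add: Abs_ell2_inverse)

lemma norm_ell2_sums: "(\<lambda>n. (norm (ell2_nth x n))\<^sup>2) sums (norm x)\<^sup>2"
  using summable_sums[OF summable_ell2[of x]]
  by (simp add: norm_ell2_def suminf_nonneg summable_ell2)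

lemma norm_ell2_nth_le: "norm (ell2_nth x n) \<le> norm x"
proof -
  have "(\<Sum>k\<in>{n}. (norm (ell2_nth x k))\<^sup>2) \<le> (norm x)\<^sup>2"
    using sum_le_suminf[OF summable_ell2, of "{n}" x] norm_ell2_sums[of x] by (simp add: sums_iff)
  then show ?thesis by (intro power2_le_imp_le[OF _ norm_ge_zero]) simp
qed

lemma bounded_linear_ell2_nth: "bounded_linear (\<lambda>x. ell2_nth x n)"
  by (rule bounded_linear_intro[where K = 1]) (simp_all add: norm_ell2_nth_le)

lemma norm_ell2_le:
  assumes "\<And>N. (\<Sum>n<N. (norm (ell2_nth x n))\<^sup>2) \<le> C\<^sup>2" and "C \<ge> 0"
  shows "norm x \<le> C"
proof -
  have "(norm x)\<^sup>2 \<le> C\<^sup>2"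
    using suminf_le_const[OF summable_ell2 assms(1)] norm_ell2_sums[of x] by (simp add: sums_iff)
  then show ?thesis using assms(2) by (rule power2_le_imp_le)
qed

section \<open>Completeness and convergence of orthogonal series\<close>

instance ell2 :: ("{real_inner, banach}") banach
proof
  fix X :: "nat \<Rightarrow> 'a ell2"
  assume X: "Cauchy X"
  \<comment> \<open>The limit is taken coordinatewise; each coordinate map is bounded, so the
    coordinates are Cauchy.\<close>
  define y where "y k = lim (\<lambda>m. ell2_nth (X m) k)" for k
  have y: "(\<lambda>m. ell2_nth (X m) k) \<longlonglongrightarrow> y k" for k
    unfolding y_def convergent_LIMSEQ_iff[symmetric]
    by (intro Cauchy_convergent bounded_linear.Cauchy[OF bounded_linear_ell2_nth X])
  \<comment> \<open>On finite partial sums \<open>n\<close> can tend to infinity in the Cauchy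
    estimate; that \<open>M\<close> does not depend on \<open>N\<close> turns the result into a norm
    bound.\<close>
  have partial: "\<exists>M. \<forall>m\<ge>M. \<forall>N. (\<Sum>k<N. (norm (ell2_nth (X m) k - y k))\<^sup>2) \<le> e\<^sup>2"
    if e: "e > 0" for e
  proof -
    obtain M where M: "\<And>m n. m \<ge> M \<Longrightarrow> n \<ge> M \<Longrightarrow> norm (X m - X n) < e"
      using CauchyD[OF X e] by blast
    have "(\<Sum>k<N. (norm (ell2_nth (X m) k - y k))\<^sup>2) \<le> e\<^sup>2" if m: "m \<ge> M" for m N
    proof (rule LIMSEQ_le_const2)
      show "(\<lambda>n. \<Sum>k<N. (norm (ell2_nth (X m) k - ell2_nth (X n) k))\<^sup>2) \<longlonglongrightarrow>
          (\<Sum>k<N. (norm (ell2_nth (X m) k - y k))\<^sup>2)"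
        by (intro tendsto_intros y)
      have "(\<Sum>k<N. (norm (ell2_nth (X m) k - ell2_nth (X n) k))\<^sup>2) \<le> e\<^sup>2" if "n \<ge> M" for n
      proof -
        have "(\<Sum>k<N. (norm (ell2_nth (X m - X n) k))\<^sup>2) \<le> (norm (X m - X n))\<^sup>2"
          using sum_le_suminf[OF summable_ell2, of "{..<N}" "X m - X n"] norm_ell2_sums[of "X m - X n"]
          by (simp add: sums_iff)
        also have "\<dots> \<le> e\<^sup>2"
          using M[OF m that] by (intro power_mono) auto
        finally show ?thesis by simp
      qed
      then show "\<exists>n0. \<forall>n\<ge>n0. (\<Sum>k<N. (norm (ell2_nth (X m) k - ell2_nth (X n) k))\<^sup>2) \<le> e\<^sup>2"
        by blast
    qed
    then show ?thesis by blast
  qed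
  obtain M where "\<And>N. (\<Sum>k<N. (norm (ell2_nth (X M) k - y k))\<^sup>2) \<le> 1\<^sup>2"
    using partial[OF zero_less_one] by blast
  then have "summable (\<lambda>k. (norm (ell2_nth (X M) k - y k))\<^sup>2)"
    by (intro summableI_nonneg_bounded) auto
  \<comment> \<open>\<open>y\<close> is square-summable as the difference of \<open>X M\<close> and
    \<open>X M - y\<close>, both of which are.\<close>
  then have "ell2_nth (X M - Abs_ell2 (\<lambda>k. ell2_nth (X M) k - y k)) k = y k" for k
    by (simp add: ell2_nth_Abs)
  then obtain Y where Y: "\<And>k. ell2_nth Y k = y k" by blast
  have "X \<longlonglongrightarrow> Y"
  proof (rule LIMSEQ_I)
    fix r :: real assume "r > 0"
    then obtain M where M: "\<And>m N. m \<ge> M \<Longrightarrow> (\<Sum>k<N. (norm (ell2_nth (X m) k - y k))\<^sup>2) \<le> (r/2)\<^sup>2"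
      using partial[OF half_gt_zero] by blast
    have "norm (X m - Y) < r" if "m \<ge> M" for m
    proof -
      have "norm (X m - Y) \<le> r/2"
        by (rule norm_ell2_le) (use M[OF that] \<open>r > 0\<close> in \<open>simp_all only: ell2_nth_diff Y half_gt_zero less_imp_le\<close>)
      then show ?thesis using \<open>r > 0\<close> by linarith
    qed
    then show "\<exists>no. \<forall>n\<ge>no. norm (X n - Y) < r" by blast
  qed
  then show "convergent X" by (rule convergentI)
qed

text \<open>By Pythagoras the squared norm of a block of \<open>h\<close> is the same block of the
  series of squared norms, so the Cauchy criterion carries over.\<close>

lemma summable_orthogonal:
  fixes h :: "nat \<Rightarrow> 'a::{real_inner, banach}"
  assumes orth: "\<And>m n. m \<noteq> n \<Longrightarrow> inner (h m) (h n) = 0"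
    and "summable (\<lambda>n. (norm (h n))\<^sup>2)"
  shows "summable h"
  unfolding summable_Cauchy
proof (intro allI impI)
  fix e :: real assume "e > 0"
  then obtain N where N: "\<And>m n. m \<ge> N \<Longrightarrow> norm (\<Sum>k=m..<n. (norm (h k))\<^sup>2) < e\<^sup>2"
    using assms(2) unfolding summable_Cauchy by (metis zero_less_power)
  have "norm (\<Sum>k=m..<n. h k) < e" if "m \<ge> N" for m n
  proof (rule power2_less_imp_less)
    have "(norm (\<Sum>k=m..<n. h k))\<^sup>2 = (\<Sum>k=m..<n. (norm (h k))\<^sup>2)"
    proof (induction n)
      case (Suc n)
      have "inner (\<Sum>k=m..<n. h k) (h n) = 0"
        by (simp add: inner_sum_left orth)
      then show ?case
        using Suc.IH by (simp add: power2_norm_eq_inner inner_add_left inner_add_right inner_commute)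
    qed simp
    then show "(norm (\<Sum>k=m..<n. h k))\<^sup>2 < e\<^sup>2"
      using N[OF that, of n] by simp
  qed (use \<open>e > 0\<close> in simp)
  then show "\<exists>N. \<forall>m\<ge>N. \<forall>n. norm (\<Sum>k=m..<n. h k) < e" by blast
qed

section \<open>The canonical basis and truncations\<close>

lemma ell2_nth_basis: "ell2_nth (basis_ell2 j) n = (if n = j then 1 else 0)"
  by (simp add: basis_ell2.rep_eq)

lemma cinner_basis: "cinner x (basis_ell2 j) = ell2_nth x j"
proof -
  have "(\<lambda>n. cinner (ell2_nth x n) (ell2_nth (basis_ell2 j) n)) = (\<lambda>n. if n = j then ell2_nth x n else 0)"
    by (auto simp: ell2_nth_basis cinner_complex_def)
  then show ?thesis
    by (simp add: cinner_ell2_def sums_unique[OF sums_single, symmetric])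
qed

lemma orthonormal_basis: "orthonormal basis_ell2"
  by (auto simp: orthonormal_def cinner_basis ell2_nth_basis)

lemma norm_basis [simp]: "norm (basis_ell2 j) = 1"
  by (rule norm_orthonormal[OF orthonormal_basis])

text \<open>This is the orthogonal projection onto the span of the first \<open>n\<close> basis
  vectors; \<open>trunc n v = v\<close> therefore expresses that \<open>v\<close> is supported below
  \<open>n\<close>.\<close>

definition trunc :: "nat \<Rightarrow> complex ell2 \<Rightarrow> complex ell2" where
  "trunc n x = (\<Sum>j<n. ell2_nth x j *\<^sub>C basis_ell2 j)"

lemma ell2_nth_sum: "ell2_nth (\<Sum>i\<in>A. f i) n = (\<Sum>i\<in>A. ell2_nth (f i) n)"
  by (induction A rule: infinite_finite_induct) auto

lemma ell2_nth_trunc: "ell2_nth (trunc n x) k = (if k < n then ell2_nth x k else 0)"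
  by (simp add: trunc_def ell2_nth_sum ell2_nth_basis if_distrib sum.delta cong: if_cong)

lemma trunc_in_span: "trunc n x \<in> scaleC.span (basis_ell2 ` {..<n})"
  unfolding trunc_def by (intro scaleC.span_sum scaleC.span_scale scaleC.span_base) auto

lemma norm_trunc_decomp: "(norm x)\<^sup>2 = (norm (x - trunc n x))\<^sup>2 + (norm (trunc n x))\<^sup>2"
  using norm_add_orthogonal[OF orthonormal_projection[OF orthonormal_basis trunc_in_span], of x n x]
  by (simp add: trunc_def cinner_basis)

lemma norm_trunc_le: "norm (trunc n x) \<le> norm x"
proof (rule power2_le_imp_le)
  show "(norm (trunc n x))\<^sup>2 \<le> (norm x)\<^sup>2"
    unfolding norm_trunc_decomp[of x n] by (rule le_add_same_cancel2[THEN iffD2]) simp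
qed simp

lemma norm_diff_trunc_le: "norm (x - trunc n x) \<le> norm x"
proof (rule power2_le_imp_le)
  show "(norm (x - trunc n x))\<^sup>2 \<le> (norm x)\<^sup>2"
    unfolding norm_trunc_decomp[of x n] by (rule le_add_same_cancel1[THEN iffD2]) simp
qed simp

lemma trunc_tendsto: "(\<lambda>n. trunc n x) \<longlonglongrightarrow> x"
proof -
  have "(\<lambda>n. (norm x)\<^sup>2 - (\<Sum>k<n. (norm (ell2_nth x k))\<^sup>2)) \<longlonglongrightarrow> (norm x)\<^sup>2 - (norm x)\<^sup>2"
    using norm_ell2_sums[of x] unfolding sums_def by (intro tendsto_intros)
  moreover have "(norm (trunc n x))\<^sup>2 = (\<Sum>k<n. (norm (ell2_nth x k))\<^sup>2)" for n
    unfolding trunc_def by (rule norm_sum_orthonormal[OF orthonormal_basis])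
  then have "(norm x)\<^sup>2 - (\<Sum>k<n. (norm (ell2_nth x k))\<^sup>2) = (norm (x - trunc n x))\<^sup>2" for n
    using norm_trunc_decomp[of x n] by simp
  ultimately have "(\<lambda>n. sqrt ((norm (x - trunc n x))\<^sup>2)) \<longlonglongrightarrow> sqrt 0"
    by (intro tendsto_real_sqrt) simp
  then have "(\<lambda>n. norm (trunc n x - x)) \<longlonglongrightarrow> 0" by (simp add: norm_minus_commute)
  then show ?thesis by (rule LIM_zero_cancel[OF tendsto_norm_zero_cancel])
qed

lemma clinear_trunc: "Vector_Spaces.linear scaleC scaleC (trunc n)"
  by (auto simp: clinear_iff intro!: ell2_eqI simp: ell2_nth_trunc)

text \<open>The span is already closed: the right side is an intersection of kernels of continuous
  coordinate maps, and each of its elements equals its own truncation. This turns the closed-span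
  condition in \<open>T1\<close> into one on matrix entries.\<close>

lemma closure_span_basis:
  "closure (scaleC.span (basis_ell2 ` {..n})) = {x. \<forall>k>n. ell2_nth x k = 0}" (is "_ = ?S")
proof
  have "?S = (\<Inter>k\<in>{n<..}. (\<lambda>x. ell2_nth x k) -` {0})" by auto
  also have "closed \<dots>"
    by (intro closed_INT ballI closed_vimage closed_singleton
        linear_continuous_on bounded_linear_ell2_nth)
  finally have "closed ?S" .
  moreover have "scaleC.span (basis_ell2 ` {..n}) \<subseteq> ?S"
    by (rule scaleC.span_minimal) (auto simp: ell2_nth_basis intro!: scaleC.subspaceI)
  ultimately show "closure (scaleC.span (basis_ell2 ` {..n})) \<subseteq> ?S"
    by (rule closure_minimal[rotated])
  show "?S \<subseteq> closure (scaleC.span (basis_ell2 ` {..n}))"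
  proof
    fix x :: "complex ell2" assume "x \<in> ?S"
    then have "x = trunc (Suc n) x"
      by (intro ell2_eqI) (auto simp: ell2_nth_trunc)
    then have "x \<in> scaleC.span (basis_ell2 ` {..n})"
      using trunc_in_span[of "Suc n" x] by (simp add: lessThan_Suc_atMost)
    then show "x \<in> closure (scaleC.span (basis_ell2 ` {..n}))"
      by (rule subsetD[OF closure_subset])
  qed
qed

text \<open>Agreement passes to truncations by linearity and to the limit by continuity.\<close>

lemma clinear_eq_on_basis:
  fixes f g :: "complex ell2 \<Rightarrow> 'b::complex_inner"
  assumes "Vector_Spaces.linear scaleC scaleC f" "Vector_Spaces.linear scaleC scaleC g"
    and "bounded_linear f" "bounded_linear g"
    and eq: "\<And>j. f (basis_ell2 j) = g (basis_ell2 j)"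
  shows "f x = g x"
proof -
  interpret f: Vector_Spaces.linear scaleC scaleC f by fact
  interpret g: Vector_Spaces.linear scaleC scaleC g by fact
  have "f (trunc n x) = g (trunc n x)" for n
    by (simp add: trunc_def f.sum g.sum f.scale g.scale eq)
  moreover have "(\<lambda>n. f (trunc n x)) \<longlonglongrightarrow> f x" "(\<lambda>n. g (trunc n x)) \<longlonglongrightarrow> g x"
    using assms(3,4) by (auto intro: bounded_linear.tendsto trunc_tendsto)
  ultimately show ?thesis
    by (metis (no_types, lifting) ext LIMSEQ_unique)
qed

section \<open>Contractions and their adjoints\<close>

locale contraction = Vector_Spaces.linear scaleC scaleC T
  for T :: "complex ell2 \<Rightarrow> complex ell2" +
  assumes norm_le: "norm (T x) \<le> norm x"

text \<open>The Hilbert space adjoint by its matrix: the \<open>j\<close>-th coordinate is the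
  product with \<open>basis_ell2 j\<close>, moved across to \<open>T\<close>. It is meaningful once
  these coordinates are square-summable, which \<open>adj_partial_sum\<close> secures for
  contractions.\<close>

definition adj :: "(complex ell2 \<Rightarrow> complex ell2) \<Rightarrow> complex ell2 \<Rightarrow> complex ell2" where
  "adj T y = Abs_ell2 (\<lambda>j. cinner y (T (basis_ell2 j)))"

context contraction
begin

lemma bounded_linear: "bounded_linear T"
  by (rule bounded_linear_contraction[OF linear_axioms norm_le])

text \<open>\<open>v\<close> is the truncated adjoint image of \<open>y\<close>. Its squared norm
  equals \<open>cinner (T v) y\<close>, hence is at most \<open>norm v * norm y\<close>; cancelling
  \<open>norm v\<close> gives the bound.\<close>

lemma adj_partial_sum: "(\<Sum>j<n. (norm (cinner y (T (basis_ell2 j))))\<^sup>2) \<le> (norm y)\<^sup>2"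
proof -
  define v where "v = (\<Sum>j<n. cinner y (T (basis_ell2 j)) *\<^sub>C basis_ell2 j)"
  have v: "(norm v)\<^sup>2 = (\<Sum>j<n. (norm (cinner y (T (basis_ell2 j))))\<^sup>2)"
    unfolding v_def by (rule norm_sum_orthonormal[OF orthonormal_basis])
  have "cinner (T v) y = (\<Sum>j<n. cinner y (T (basis_ell2 j)) * cnj (cinner y (T (basis_ell2 j))))"
    by (simp add: v_def sum scale cinner_sum_left cinner_scaleC_left flip: cinner_commute)
  also have "\<dots> = complex_of_real ((norm v)\<^sup>2)"
    by (simp only: v of_real_sum complex_norm_square)
  finally have "(norm v)\<^sup>2 = norm (cinner (T v) y)" by (simp add: norm_power)
  also have "\<dots> \<le> norm v * norm y"
    using norm_cinner_le[of "T v" y] norm_le[of v]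
    by (meson mult_right_mono norm_ge_zero order_trans)
  finally have "norm v \<le> norm y"
    by (cases "norm v = 0") (auto simp: power2_eq_square)
  then show ?thesis unfolding v[symmetric] by (intro power_mono) auto
qed

lemma ell2_nth_adj: "ell2_nth (adj T y) j = cinner y (T (basis_ell2 j))"
  unfolding adj_def
  by (subst ell2_nth_Abs) (auto intro!: summableI_nonneg_bounded adj_partial_sum)

lemma norm_adj_le: "norm (adj T y) \<le> norm y"
  by (rule norm_ell2_le) (auto simp: ell2_nth_adj adj_partial_sum)

lemma cinner_adj: "cinner (T x) y = cinner x (adj T y)"
proof (rule clinear_eq_on_basis[where f = "\<lambda>x. cinner (T x) y"])
  show "bounded_linear (\<lambda>x. cinner (T x) y)"
    by (rule bounded_linear_compose[OF bounded_linear_cinner_left bounded_linear])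
  show "cinner (T (basis_ell2 j)) y = cinner (basis_ell2 j) (adj T y)" for j
    using cinner_basis[of "adj T y" j] ell2_nth_adj[of y j] by (metis cinner_commute)
qed (auto simp: clinear_iff add scale cinner_add_left cinner_scaleC_left bounded_linear_cinner_left)

lemma contraction_adj: "contraction (adj T)"
proof -
  have "Vector_Spaces.linear scaleC scaleC (adj T)"
    by (auto simp: clinear_iff ell2_nth_adj cinner_add_left cinner_scaleC_left intro!: ell2_eqI)
  then show ?thesis
    by (simp add: contraction_def contraction_axioms_def norm_adj_le)
qed

section \<open>Powers and strong stability\<close>

lemma funpow_clinear: "Vector_Spaces.linear scaleC scaleC (T ^^ n)"
  by (induction n) (auto simp: clinear_iff add scale)

lemma norm_funpow_le: "norm ((T ^^ n) x) \<le> norm x"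
  by (induction n) (auto intro: order_trans[OF norm_le])

text \<open>The norms of the iterates do not increase, so one small iterate of a basis vector makes
  all later ones small. Linearity extends this to truncations, and the uniform bound on the powers
  absorbs the tail.\<close>

lemma funpow_tendsto_zero:
  assumes "\<And>j e. e > 0 \<Longrightarrow> \<exists>n. norm ((T ^^ n) (basis_ell2 j)) < e"
  shows "(\<lambda>n. (T ^^ n) x) \<longlonglongrightarrow> 0"
proof -
  have basis: "(\<lambda>n. (T ^^ n) (basis_ell2 j)) \<longlonglongrightarrow> 0" for j
  proof (rule LIMSEQ_I)
    fix e :: real assume "e > 0"
    then obtain n where n: "norm ((T ^^ n) (basis_ell2 j)) < e" using assms by blast
    have "norm ((T ^^ (k + n)) (basis_ell2 j)) < e" for k
      using norm_funpow_le[of k "(T ^^ n) (basis_ell2 j)"] n by (simp add: funpow_add)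
    then show "\<exists>no. \<forall>n\<ge>no. norm ((T ^^ n) (basis_ell2 j) - 0) < e"
      by (metis diff_zero le_add_diff_inverse2)
  qed
  show ?thesis
  proof (rule LIMSEQ_I)
    fix e :: real assume e: "e > 0"
    obtain m where m: "norm (trunc m x - x) < e / 2"
      using LIMSEQ_D[OF trunc_tendsto half_gt_zero[OF e]] by blast
    have "(T ^^ n) (trunc m x) = (\<Sum>j<m. ell2_nth x j *\<^sub>C (T ^^ n) (basis_ell2 j))" for n
    proof -
      interpret Tn: Vector_Spaces.linear scaleC scaleC "T ^^ n" by (rule funpow_clinear)
      show ?thesis by (simp add: trunc_def Tn.sum Tn.scale)
    qed
    moreover have "(\<lambda>n. \<Sum>j<m. ell2_nth x j *\<^sub>C (T ^^ n) (basis_ell2 j)) \<longlonglongrightarrow> (\<Sum>j<m. 0)"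
    proof (rule tendsto_sum)
      fix j
      have "(\<lambda>n. norm (ell2_nth x j *\<^sub>C (T ^^ n) (basis_ell2 j))) \<longlonglongrightarrow> 0"
        unfolding norm_scaleC by (intro tendsto_mult_right_zero tendsto_norm_zero basis)
      then show "(\<lambda>n. ell2_nth x j *\<^sub>C (T ^^ n) (basis_ell2 j)) \<longlonglongrightarrow> 0"
        by (rule tendsto_norm_zero_cancel)
    qed
    ultimately have "(\<lambda>n. (T ^^ n) (trunc m x)) \<longlonglongrightarrow> 0" by simp
    then obtain n0 where n0: "\<And>n. n \<ge> n0 \<Longrightarrow> norm ((T ^^ n) (trunc m x)) < e / 2"
      using LIMSEQ_D[of "\<lambda>n. (T ^^ n) (trunc m x)" 0, OF _ half_gt_zero[OF e]] by auto
    have "norm ((T ^^ n) x) < e" if "n \<ge> n0" for n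
    proof -
      have "(T ^^ n) (trunc m x + (x - trunc m x)) = (T ^^ n) (trunc m x) + (T ^^ n) (x - trunc m x)"
        using funpow_clinear[of n] unfolding clinear_iff by blast
      then have "(T ^^ n) x = (T ^^ n) (trunc m x) + (T ^^ n) (x - trunc m x)"
        unfolding add.commute[of "trunc m x" "x - trunc m x"] diff_add_cancel .
      then have "norm ((T ^^ n) x) \<le> norm ((T ^^ n) (trunc m x)) + norm ((T ^^ n) (x - trunc m x))"
        by (metis norm_triangle_ineq)
      then show ?thesis
        using n0[OF that] m norm_funpow_le[of n "x - trunc m x"] by (simp add: norm_minus_commute)
    qed
    then show "\<exists>no. \<forall>n\<ge>no. norm ((T ^^ n) x - 0) < e" by auto
  qed
qed

text \<open>Approximate preimages in the unit ball force the adjoint image of a basis vector to have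
  norm at least 1. Expanding the square then bounds the squared distance from its image under
  \<open>T\<close> to the basis vector by 1 - 2 + 1 = 0. Linearity and continuity do the
  rest.\<close>

lemma T_adj_eqI:
  assumes "\<And>j e. e > 0 \<Longrightarrow> \<exists>x. norm x \<le> 1 \<and> norm (T x - basis_ell2 j) < e"
  shows "T (adj T y) = y"
proof -
  interpret adj: contraction "adj T" by (rule contraction_adj)
  have basis: "T (adj T (basis_ell2 j)) = basis_ell2 j" for j
  proof -
    let ?y = "basis_ell2 j" and ?a = "adj T (basis_ell2 j)"
    have "1 \<le> norm ?a + e" if "e > 0" for e
    proof -
      obtain x where x: "norm x \<le> 1" "norm (T x - ?y) < e" using assms[OF \<open>e > 0\<close>] by blast
      have "1 = cmod (cinner ?y ?y)" by (simp add: cinner_same)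
      also have "cinner ?y ?y = cinner x ?a - cinner (T x - ?y) ?y"
        by (simp add: cinner_diff_left cinner_adj)
      also have "cmod \<dots> \<le> cmod (cinner x ?a) + cmod (cinner (T x - ?y) ?y)"
        by (rule norm_triangle_ineq4)
      also have "\<dots> \<le> norm x * norm ?a + norm (T x - ?y) * norm ?y"
        by (intro add_mono norm_cinner_le)
      also have "\<dots> \<le> 1 * norm ?a + e"
        using x by (intro add_mono mult_right_mono) auto
      finally show ?thesis by simp
    qed
    then have "1 \<le> norm ?a" by (rule field_le_epsilon)
    then have "1 \<le> (norm ?a)\<^sup>2" by (simp add: one_le_power)
    moreover have "(norm (T ?a))\<^sup>2 \<le> 1"
      using norm_le[of ?a] norm_adj_le[of ?y] by (intro power_le_one) auto
    moreover have "inner (T ?a) ?y = (norm ?a)\<^sup>2"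
      by (simp add: cinner_adj cinner_same flip: Re_cinner)
    moreover have "(norm (T ?a - ?y))\<^sup>2 = (norm (T ?a))\<^sup>2 - 2 * inner (T ?a) ?y + (norm ?y)\<^sup>2"
      unfolding power2_norm_eq_inner by (simp add: inner_diff_left inner_diff_right inner_commute)
    ultimately have "(norm (T ?a - ?y))\<^sup>2 \<le> 0"
      unfolding norm_basis power_one by linarith
    then show ?thesis by simp
  qed
  have "bounded_linear (\<lambda>y. T (adj T y))"
    by (rule bounded_linear_compose[OF bounded_linear adj.bounded_linear])
  then show ?thesis
    by (intro clinear_eq_on_basis[where f = "\<lambda>y. T (adj T y)" and g = "\<lambda>y. y", OF _ _ _ _ basis])
      (simp_all add: clinear_iff add scale adj.add adj.scale bounded_linear_ident)
qed

text \<open>Only the one dimension spanned by \<^term>\<open>w\<close> is needed to reach a single unit vector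
  \<^term>\<open>y\<close>, so the square root of the defect operator is avoided.\<close>

lemma one_dimensional_extension:
  obtains w t where
    "\<And>u s. (norm (T u + s *\<^sub>C w))\<^sup>2 \<le> (norm u)\<^sup>2 + (cmod s)\<^sup>2"
    "T (adj T y) + t *\<^sub>C w = y" "(norm (adj T y))\<^sup>2 + (cmod t)\<^sup>2 = (norm y)\<^sup>2"
    "\<exists>r. w = r *\<^sub>C (y - T (adj T y))"
proof -
  interpret adj: contraction "adj T" by (rule contraction_adj)
  define a where "a = adj T y"
  define d where "d = (norm y)\<^sup>2 - (norm a)\<^sup>2"
  have d: "d \<ge> 0"
    unfolding d_def a_def using power_mono[OF norm_adj_le, of y 2] by simp
  \<comment> \<open>\<open>t\<close> makes \<open>a\<close> and \<open>t\<close> together carry the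
    norm of \<open>y\<close>, and \<open>w\<close> is such that \<open>T a\<close> and
    \<open>t\<close> times \<open>w\<close> add up to \<open>y\<close>. If \<open>t = 0\<close>,
    then \<open>inverse t = 0\<close> makes \<open>w\<close> vanish.\<close>
  define t where "t = complex_of_real (sqrt d)"
  define w where "w = inverse t *\<^sub>C (y - T a)"
  have t: "(cmod t)\<^sup>2 = d" using d by (simp add: t_def)
  have inner_adj: "inner (T x) z = inner x (adj T z)" for x z
    by (simp add: cinner_adj flip: Re_cinner)
  show ?thesis
  proof (rule that[of w t])
    fix u s
    define c where "c = s * inverse t"
    \<comment> \<open>This shift trades the defect \<open>y - T a\<close> for \<open>y\<close>:
      \<open>T u\<close> plus \<open>s\<close> times \<open>w\<close> becomes \<open>T v\<close>
      plus \<open>c\<close> times \<open>y\<close>, and the cross term moves to \<open>a\<close> by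
      adjointness.\<close>
    define v where "v = u - c *\<^sub>C a"
    have "T u + s *\<^sub>C w = T v + c *\<^sub>C y"
      by (simp add: v_def w_def c_def diff scale scaleC_scaleC scaleC.scale_right_diff_distrib)
    then have "(norm (T u + s *\<^sub>C w))\<^sup>2 = (norm (T v))\<^sup>2 + 2 * inner v (c *\<^sub>C a) + (norm (c *\<^sub>C y))\<^sup>2"
      by (simp add: power2_norm_eq_inner inner_add_left inner_add_right inner_commute[of "c *\<^sub>C y" "T v"]
          inner_adj adj.scale a_def)
    also have "\<dots> \<le> (norm v)\<^sup>2 + 2 * inner v (c *\<^sub>C a) + (norm (c *\<^sub>C y))\<^sup>2"
      by (intro add_right_mono power_mono norm_le norm_ge_zero)
    also have "\<dots> = (norm (v + c *\<^sub>C a))\<^sup>2 + ((norm (c *\<^sub>C y))\<^sup>2 - (norm (c *\<^sub>C a))\<^sup>2)"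
      by (simp add: power2_norm_eq_inner inner_add_left inner_add_right inner_commute[of "c *\<^sub>C a" v])
    also have "\<dots> = (norm u)\<^sup>2 + (cmod c)\<^sup>2 * d"
      by (simp add: v_def norm_scaleC power_mult_distrib d_def right_diff_distrib)
    also have "(cmod c)\<^sup>2 * d \<le> (cmod s)\<^sup>2"
      unfolding t[symmetric] by (cases "t = 0") (simp_all add: c_def divide_inverse[symmetric] norm_divide power_divide)
    finally show "(norm (T u + s *\<^sub>C w))\<^sup>2 \<le> (norm u)\<^sup>2 + (cmod s)\<^sup>2" by simp
  next
    show "T (adj T y) + t *\<^sub>C w = y"
    proof (cases "t = 0")
      \<comment> \<open>Here \<open>a\<close> has the same norm as \<open>y\<close>, which forces
        \<open>T a = y\<close>.\<close>
      case True
      then have "(norm a)\<^sup>2 = (norm y)\<^sup>2" using t by (simp add: d_def)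
      moreover have "inner (T a) y = (norm a)\<^sup>2"
        by (simp add: inner_adj a_def power2_norm_eq_inner)
      moreover have "(norm (T a))\<^sup>2 \<le> (norm a)\<^sup>2" by (intro power_mono norm_le norm_ge_zero)
      moreover have "(norm (T a - y))\<^sup>2 = (norm (T a))\<^sup>2 - 2 * inner (T a) y + (norm y)\<^sup>2"
        by (simp add: power2_norm_eq_inner inner_diff_left inner_diff_right inner_commute)
      ultimately have "(norm (T a - y))\<^sup>2 \<le> 0" by linarith
      then show ?thesis using True by (simp add: a_def)
    next
      case False
      then show ?thesis by (simp add: w_def a_def scaleC_scaleC scaleC_one)
    qed
    show "(norm (adj T y))\<^sup>2 + (cmod t)\<^sup>2 = (norm y)\<^sup>2"
      by (simp add: t d_def a_def)
    show "\<exists>r. w = r *\<^sub>C (y - T (adj T y))"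
      unfolding w_def a_def by blast
  qed
qed

end

section \<open>The backward shift as a model\<close>

locale stable_coisometry = contraction +
  assumes T_adj: "T (adj T y) = y"
    and stable: "(\<lambda>n. (T ^^ n) x) \<longlonglongrightarrow> 0"
begin

sublocale adj: contraction "adj T"
  by (rule contraction_adj)

text \<open>Since \<open>adj T\<close> is isometric here, \<open>adj T (T x)\<close> is the
  orthogonal projection of \<open>x\<close> onto the range of \<open>adj T\<close>; so
  \<open>Q\<close> projects onto the complement of this range, which is the kernel of
  \<open>T\<close>.\<close>

definition Q :: "complex ell2 \<Rightarrow> complex ell2" where
  "Q x = x - adj T (T x)"

lemma norm_adj: "norm (adj T y) = norm y"
proof -
  have "cinner (adj T y) (adj T y) = cinner y y"
    by (simp add: T_adj flip: cinner_adj)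
  then show ?thesis by (simp add: cinner_same flip: of_real_power)
qed

lemma T_Q: "T (Q x) = 0"
  by (simp add: Q_def diff T_adj)

lemma clinear_Q: "Vector_Spaces.linear scaleC scaleC Q"
  by (simp add: clinear_iff Q_def add scale adj.add adj.scale scaleC.scale_right_diff_distrib)

text \<open>\<open>Q x\<close> lies in the kernel, hence is orthogonal to the range of
  \<open>adj T\<close>; Pythagoras applies, and \<open>adj T\<close> preserves the norm of
  \<open>T x\<close>.\<close>

lemma norm_Q_T: "(norm x)\<^sup>2 = (norm (Q x))\<^sup>2 + (norm (T x))\<^sup>2"
proof -
  have "cinner (Q x) (adj T (T x)) = 0"
    by (simp add: T_Q flip: cinner_adj)
  from norm_add_orthogonal[OF this] show ?thesis
    by (simp add: Q_def norm_adj)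
qed

lemma norm_Q_le: "norm (Q x) \<le> norm x"
proof (rule power2_le_imp_le)
  show "(norm (Q x))\<^sup>2 \<le> (norm x)\<^sup>2"
    unfolding norm_Q_T[of x] by (rule le_add_same_cancel1[THEN iffD2]) simp
qed simp

lemma Q_kernel: "T x = 0 \<Longrightarrow> Q x = x"
  by (simp add: Q_def)

lemma cinner_adj_kernel: "T k = 0 \<Longrightarrow> cinner (adj T y) k = 0"
  using cinner_adj[of k y] by (simp add: cinner_eq_zero_commute)

lemma cinner_Q: "T k = 0 \<Longrightarrow> cinner (Q x) k = cinner x k"
  by (simp add: Q_def cinner_diff_left cinner_adj_kernel)

lemma funpow_zero: "(T ^^ n) 0 = 0"
  by (induction n) simp_all

lemma funpow_adj: "(T ^^ m) ((adj T ^^ (m + n)) y) = (adj T ^^ n) y"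
proof (induction m)
  case (Suc m)
  have "T ^^ Suc m = T ^^ m \<circ> T" by (rule funpow_Suc_right)
  then show ?case
    by (simp only: add_Suc funpow.simps(2)[of _ "adj T"] o_apply T_adj Suc.IH)
qed simp

lemma funpow_adj_kernel:
  assumes "T k = 0" and "n < m"
  shows "(T ^^ m) ((adj T ^^ n) k) = 0"
proof -
  obtain d where d: "m = Suc d + n" using less_imp_Suc_add[OF assms(2)] by auto
  then have "(T ^^ m) ((adj T ^^ n) k) = (T ^^ Suc d) k"
    using funpow_adj[of n 0 k] by (simp only: funpow_add o_def add_0_right funpow_0)
  then show ?thesis by (simp only: funpow_Suc_right o_def assms(1) funpow_zero)
qed

lemma norm_adj_funpow: "norm ((adj T ^^ n) y) = norm y"
  by (induction n) (simp_all add: norm_adj)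

end

text \<open>\<^term>\<open>f\<close> is an orthonormal basis of the kernel of \<^term>\<open>T\<close>, and \<^term>\<open>Q\<close> is the
  orthogonal projection onto that kernel.\<close>

locale stable_coisometry_basis = stable_coisometry +
  fixes f :: "nat \<Rightarrow> complex ell2"
  assumes f: "orthonormal f"
    and span_f: "scaleC.span (f ` {..<n}) = scaleC.span ((\<lambda>j. Q (basis_ell2 j)) ` {..<n})"
begin

interpretation Q: Vector_Spaces.linear scaleC scaleC Q by (rule clinear_Q)

lemma T_f: "T (f k) = 0"
proof -
  have "f k \<in> scaleC.span (f ` {..<Suc k})" by (intro scaleC.span_base) auto
  also have "\<dots> = Q ` scaleC.span (basis_ell2 ` {..<Suc k})"
    unfolding span_f by (simp add: image_image flip: Q.span_image)
  finally show ?thesis by (auto simp: T_Q)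
qed

text \<open>\<open>Q\<close> maps truncations of \<open>x\<close> into the spans of \<open>f\<close>
  and does not increase norms, so \<open>Q x\<close> is in the closed span of \<open>f\<close>. Its
  coefficients are those of \<open>x\<close> because \<open>f\<close> lies in the kernel.\<close>

lemma parseval_Q: "(\<lambda>k. (cmod (cinner x (f k)))\<^sup>2) sums (norm (Q x))\<^sup>2"
proof -
  have "(\<lambda>k. (cmod (cinner (Q x) (f k)))\<^sup>2) sums (norm (Q x))\<^sup>2"
  proof (rule parseval[OF f])
    fix e :: real assume "e > 0"
    then obtain n where n: "norm (trunc n x - x) < e"
      using LIMSEQ_D[OF trunc_tendsto] by blast
    have "Q (trunc n x) \<in> Q ` scaleC.span (basis_ell2 ` {..<n})"
      by (intro imageI trunc_in_span)
    also have "\<dots> = scaleC.span (f ` {..<n})"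
      unfolding span_f by (simp add: image_image flip: Q.span_image)
    finally have "Q (trunc n x) \<in> scaleC.span (f ` {..<n})" .
    moreover have "norm (Q x - Q (trunc n x)) < e"
      using norm_Q_le[of "x - trunc n x"] n by (simp add: Q.diff norm_minus_commute)
    ultimately show "\<exists>n. \<exists>s\<in>scaleC.span (f ` {..<n}). norm (Q x - s) < e" by blast
  qed
  then show ?thesis by (simp add: cinner_Q T_f)
qed

text \<open>These are the coordinates of \<open>Q x\<close> in the basis \<open>f\<close>, read off
  from \<open>x\<close> itself because each \<open>f k\<close> lies in the kernel.\<close>

definition W :: "complex ell2 \<Rightarrow> complex ell2" where
  "W x = Abs_ell2 (\<lambda>k. cinner x (f k))"

lemma ell2_nth_W: "ell2_nth (W x) k = cinner x (f k)"
  unfolding W_def by (subst ell2_nth_Abs) (use summable_bessel[OF f] in auto)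

lemma norm_W: "norm (W x) = norm (Q x)"
  using norm_ell2_sums[of "W x"] parseval_Q[of x]
  by (simp add: ell2_nth_W sums_iff)

lemma clinear_W: "Vector_Spaces.linear scaleC scaleC W"
  by (auto simp: clinear_iff ell2_nth_W cinner_add_left cinner_scaleC_left intro!: ell2_eqI)

lemma bounded_linear_W: "bounded_linear W"
  by (rule bounded_linear_contraction[OF clinear_W]) (simp add: norm_W norm_Q_le)

lemma W_adj: "W (adj T y) = 0"
  by (intro ell2_eqI) (simp add: ell2_nth_W cinner_adj_kernel T_f)

lemma W_surj:
  obtains x where "T x = 0" "W x = b" "norm x = norm b"
proof -
  define h where "h k = ell2_nth b k *\<^sub>C f k" for k
  have orth: "cinner (h m) (h n) = 0" if "m \<noteq> n" for m n
    using f that by (simp add: h_def cinner_scaleC_left cinner_scaleC_right orthonormal_def)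
  have h: "summable h"
  proof (rule summable_orthogonal)
    show "inner (h m) (h n) = 0" if "m \<noteq> n" for m n
      using orth[OF that] by (simp flip: Re_cinner)
    show "summable (\<lambda>n. (norm (h n))\<^sup>2)"
      using summable_ell2[of b] by (simp add: h_def norm_scaleC norm_orthonormal[OF f])
  qed
  define x where "x = suminf h"
  have "T x = (\<Sum>k. T (h k))"
    unfolding x_def by (rule bounded_linear.suminf[OF bounded_linear h])
  then have Tx: "T x = 0" by (simp add: h_def scale T_f)
  have "cinner x (f k) = ell2_nth b k" for k
  proof -
    have "cinner x (f k) = (\<Sum>j. cinner (h j) (f k))"
      unfolding x_def by (rule bounded_linear.suminf[OF bounded_linear_cinner_left h])
    also have "\<dots> = (\<Sum>j. if j = k then ell2_nth b j else 0)"
      by (rule arg_cong[where f = suminf])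
        (use f in \<open>auto simp: h_def cinner_scaleC_left orthonormal_def\<close>)
    also have "\<dots> = ell2_nth b k"
      by (rule sums_unique[OF sums_single, symmetric])
    finally show ?thesis .
  qed
  then have "W x = b"
    by (intro ell2_eqI) (simp add: ell2_nth_W)
  then show ?thesis
    using that[OF Tx] norm_W[of x] Q_kernel[OF Tx] by simp
qed

section \<open>The unitary intertwining \<open>T\<close> with the backward shift\<close>

definition U :: "complex ell2 \<Rightarrow> complex ell2 ell2" where
  "U x = Abs_ell2 (\<lambda>n. W ((T ^^ n) x))"

text \<open>The terms are differences of consecutive squared norms of the iterates; the series
  telescopes, and stability removes the limit term.\<close>

lemma sums_W_funpow: "(\<lambda>n. (norm (W ((T ^^ n) x)))\<^sup>2) sums (norm x)\<^sup>2"
proof -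
  have "(\<lambda>n. (norm ((T ^^ n) x))\<^sup>2) \<longlonglongrightarrow> (norm (0 :: complex ell2))\<^sup>2"
    by (intro tendsto_intros stable)
  then have "(\<lambda>n. (norm ((T ^^ n) x))\<^sup>2 - (norm ((T ^^ Suc n) x))\<^sup>2) sums ((norm ((T ^^ 0) x))\<^sup>2 - (norm (0 :: complex ell2))\<^sup>2)"
    by (rule telescope_sums')
  then show ?thesis
    using norm_Q_T[of "(T ^^ _) x"] by (simp add: norm_W)
qed

lemma ell2_nth_U: "ell2_nth (U x) n = W ((T ^^ n) x)"
  unfolding U_def by (subst ell2_nth_Abs) (use sums_W_funpow[of x] in \<open>auto simp: sums_iff\<close>)

lemma norm_U: "norm (U x) = norm x"
  using norm_ell2_sums[of "U x"] sums_W_funpow[of x]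
  by (simp add: ell2_nth_U sums_iff)

lemma clinear_U: "Vector_Spaces.linear scaleC scaleC U"
  using funpow_clinear clinear_W by (auto simp: clinear_iff ell2_nth_U intro!: ell2_eqI)

lemma U_shift: "U (T x) = backward_shift (U x)"
  by (rule ell2_eqI) (simp add: ell2_nth_U backward_shift.rep_eq funpow_swap1)

lemma surj_U: "surj U"
  unfolding surj_def
proof
  fix a :: "complex ell2 ell2"
  obtain v where v: "\<And>n. T (v n) = 0" "\<And>n. W (v n) = ell2_nth a n" "\<And>n. norm (v n) = norm (ell2_nth a n)"
  proof -
    have "\<forall>n. \<exists>x. T x = 0 \<and> W x = ell2_nth a n \<and> norm x = norm (ell2_nth a n)"
      using W_surj by blast
    from choice[OF this] show ?thesis using that by blast
  qed
  \<comment> \<open>The preimage is the sum of these vectors: \<open>T ^^ n\<close> brings back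
    \<open>v n\<close>, and the isometric \<open>adj T\<close> moves the kernel through mutually
    orthogonal subspaces.\<close>
  define h where "h n = (adj T ^^ n) (v n)" for n
  have orth: "cinner (h (m + Suc d)) (h m) = 0" for m d
  proof -
    have "cinner ((adj T ^^ m) x) ((adj T ^^ m) y) = cinner x y" for x y
      by (induction m) (simp_all add: T_adj flip: cinner_adj)
    moreover have "h (m + Suc d) = (adj T ^^ m) (adj T ((adj T ^^ d) (v (m + Suc d))))"
      unfolding h_def by (simp only: funpow_add funpow.simps(2) o_apply)
    ultimately show ?thesis
      by (simp add: h_def cinner_adj_kernel v(1))
  qed
  have h: "summable h"
  proof (rule summable_orthogonal)
    show "inner (h m) (h n) = 0" if "m \<noteq> n" for m n
    proof (cases "n < m")
      case True
      then show ?thesis using orth[of n] by (auto dest!: less_imp_Suc_add simp flip: Re_cinner)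
    next
      case False
      with that have "m < n" by simp
      then show ?thesis using orth[of m] by (subst inner_commute) (auto dest!: less_imp_Suc_add simp flip: Re_cinner)
    qed
    show "summable (\<lambda>n. (norm (h n))\<^sup>2)"
      using summable_ell2[of a] by (simp add: h_def norm_adj_funpow v(3))
  qed
  have "W ((T ^^ m) (suminf h)) = ell2_nth a m" for m
  proof -
    have "bounded_linear (T ^^ m)"
      by (rule bounded_linear_contraction[OF funpow_clinear norm_funpow_le])
    then have bl: "bounded_linear (\<lambda>x. W ((T ^^ m) x))"
      by (rule bounded_linear_compose[OF bounded_linear_W])
    \<comment> \<open>\<open>T ^^ m\<close> annihilates the terms with \<open>n < m\<close>,
      recovers \<open>v m\<close> for \<open>n = m\<close>, and leaves the later ones in the range
      of \<open>adj T\<close>, where \<open>W\<close> vanishes.\<close>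
    have "W ((T ^^ m) (h n)) = (if n = m then ell2_nth a n else 0)" for n
    proof (cases rule: linorder_cases[of n m])
      case less
      then show ?thesis
        using clinear_W by (simp add: h_def funpow_adj_kernel v(1) module_hom.zero linear_iff_module_hom)
    next
      case equal
      then show ?thesis using funpow_adj[of m 0] by (simp add: h_def v(2))
    next
      case greater
      then obtain d where "n = m + Suc d" by (auto dest!: less_imp_Suc_add)
      then show ?thesis by (simp add: h_def funpow_adj W_adj del: add_Suc_right)
    qed
    then have "W ((T ^^ m) (suminf h)) = (\<Sum>n. if n = m then ell2_nth a n else 0)"
      using bounded_linear.suminf[OF bl h] by simp
    also have "\<dots> = ell2_nth a m" by (rule sums_unique[OF sums_single, symmetric])
    finally show ?thesis .
  qed
  then have "a = U (suminf h)"
    by (intro ell2_eqI) (simp add: ell2_nth_U)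
  then show "\<exists>x. a = U x" ..
qed

lemma unitarily_equivalent_shift:
  "unitarily_equivalent T (backward_shift :: complex ell2 ell2 \<Rightarrow> complex ell2 ell2)"
  unfolding unitarily_equivalent_def
proof (intro exI conjI allI)
  interpret U: Vector_Spaces.linear scaleC scaleC U by (rule clinear_U)
  have "inj U"
    unfolding U.inj_iff_eq_0 by (metis norm_U norm_eq_zero)
  then show "bij U" using surj_U by (rule bijI)
qed (auto intro: clinear_U cinner_isometry norm_U U_shift)

end

context stable_coisometry
begin

text \<open>By \<open>norm_Q_T\<close>, strictness makes \<open>Q\<close> injective on finitely
  supported vectors, so the vectors \<open>Q (basis_ell2 j)\<close> are independent and Gram-Schmidt
  yields the basis \<open>f\<close> of the model.\<close>

lemma unitarily_equivalent_shift:
  assumes strict: "\<And>n v. v \<noteq> 0 \<Longrightarrow> trunc n v = v \<Longrightarrow> norm (T v) < norm v"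
  shows "unitarily_equivalent T (backward_shift :: complex ell2 ell2 \<Rightarrow> complex ell2 ell2)"
proof -
  interpret Q: Vector_Spaces.linear scaleC scaleC Q by (rule clinear_Q)
  have "Q (basis_ell2 n) \<notin> scaleC.span ((\<lambda>j. Q (basis_ell2 j)) ` {..<n})" for n
  proof
    assume "Q (basis_ell2 n) \<in> scaleC.span ((\<lambda>j. Q (basis_ell2 j)) ` {..<n})"
    also have "\<dots> = Q ` scaleC.span (basis_ell2 ` {..<n})"
      by (simp add: image_image flip: Q.span_image)
    finally obtain z where z: "z \<in> scaleC.span (basis_ell2 ` {..<n})" "Q (basis_ell2 n) = Q z"
      by blast
    have "scaleC.span (basis_ell2 ` {..<n}) \<subseteq> {x. \<forall>k\<ge>n. ell2_nth x k = 0}"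
      by (rule scaleC.span_minimal) (auto simp: ell2_nth_basis intro!: scaleC.subspaceI)
    with z(1) have zn: "ell2_nth z k = 0" if "k \<ge> n" for k using that by blast
    \<comment> \<open>A dependence would put this finitely supported vector into the kernel of
      \<open>Q\<close>; its coordinate 1 at \<open>n\<close> keeps it nonzero.\<close>
    define v where "v = basis_ell2 n - z"
    have "ell2_nth v n = 1" by (simp add: v_def ell2_nth_basis zn)
    then have "v \<noteq> 0" by auto
    moreover have "trunc (Suc n) v = v"
      by (rule ell2_eqI) (auto simp: ell2_nth_trunc v_def ell2_nth_basis zn)
    ultimately have "norm (T v) < norm v" by (rule strict)
    moreover have "Q v = 0" by (simp add: v_def Q.diff z(2))
    then have "(norm v)\<^sup>2 = (norm (T v))\<^sup>2" using norm_Q_T[of v] by simp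
    ultimately show False by simp
  qed
  then obtain f where "orthonormal f"
    "\<And>n. scaleC.span (f ` {..<n}) = scaleC.span ((\<lambda>j. Q (basis_ell2 j)) ` {..<n})"
    using gram_schmidt[of "\<lambda>j. Q (basis_ell2 j)"] by blast
  then interpret stable_coisometry_basis T f by unfold_locales
  show ?thesis by (rule unitarily_equivalent_shift)
qed

end

section \<open>Dense open subsets of the contractions with positive subdiagonal\<close>

lemma nowhere_dense_in_subset:
  assumes "nowhere_dense_in X A" and "B \<subseteq> A"
  shows "nowhere_dense_in X B"
proof -
  have "X interior_of (X closure_of B) \<subseteq> X interior_of (X closure_of A)"
    by (intro interior_of_mono closure_of_mono assms(2))
  then show ?thesis using assms by (auto simp: nowhere_dense_in_def)
qed

text \<open>The complement of a dense open set is closed with empty interior. An enumeration of the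
  family, possibly with repetitions, supplies the sequence of nowhere dense sets.\<close>

lemma typical_inI:
  assumes "countable \<O>" "\<O> \<noteq> {}"
    and op: "\<And>V. V \<in> \<O> \<Longrightarrow> openin X V" and dense: "\<And>V. V \<in> \<O> \<Longrightarrow> X closure_of V = topspace X"
    and P: "\<And>x. x \<in> topspace X \<Longrightarrow> (\<And>V. V \<in> \<O> \<Longrightarrow> x \<in> V) \<Longrightarrow> P x"
  shows "typical_in X P"
proof -
  \<comment> \<open>\<open>meager_in\<close> demands an exact union; intersecting with the failure
    of \<open>P\<close> produces precisely the complement of the typical set, and subsets stay
    nowhere dense.\<close>
  define N where "N n = (topspace X - from_nat_into \<O> n) \<inter> {x. \<not> P x}" for n
  have "nowhere_dense_in X (N n)" for n
  proof (rule nowhere_dense_in_subset)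
    have "from_nat_into \<O> n \<in> \<O>" by (rule from_nat_into[OF assms(2)])
    note V = op[OF this] dense[OF this]
    have "X closure_of (topspace X - from_nat_into \<O> n) = topspace X - from_nat_into \<O> n"
      by (intro closure_of_closedin closedin_diff V closedin_topspace)
    then show "nowhere_dense_in X (topspace X - from_nat_into \<O> n)"
      by (simp add: nowhere_dense_in_def interior_of_complement V)
  qed (auto simp: N_def)
  moreover have "topspace X - {x \<in> topspace X. P x} = (\<Union>n. N n)"
  proof -
    have "\<exists>n. x \<notin> from_nat_into \<O> n" if "x \<in> topspace X" "\<not> P x" for x
      using P[OF that(1)] that(2) from_nat_into_surj[OF assms(1)] by metis
    then show ?thesis by (auto simp: N_def)
  qed
  ultimately show ?thesis
    unfolding typical_in_def comeager_in_def meager_in_def by blast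
qed

section \<open>The strong operator topology on \<open>T1\<close>\<close>

abbreviation (input) T1_top :: "(complex ell2 \<Rightarrow>\<^sub>L complex ell2) topology" where
  "T1_top \<equiv> subtopology strong_operator_topology T1"

lemma topspace_T1_top [simp]: "topspace T1_top = T1"
  by (simp add: strong_operator_topology_topspace)

declare strong_operator_topology_topspace [simp]

lemma openin_T1_preimage:
  assumes "continuous_map T1_top euclidean f" and "open V"
  shows "openin T1_top {T \<in> T1. f T \<in> V}"
  using openin_continuous_map_preimage[OF assms(1), of V] assms(2) by simp

lemma continuous_map_evaluation: "continuous_map T1_top euclidean (\<lambda>T. blinfun_apply T x)"
  by (intro continuous_map_from_subtopology strong_operator_topology_continuous_evaluation)

text \<open>The topology is pulled back from the product topology along
  \<open>blinfun_apply\<close>, so pointwise convergence makes the \<open>S n\<close> enter every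
  neighbourhood of \<open>T\<close>.\<close>

lemma closure_of_T1_sequence:
  assumes T: "T \<in> T1" and S: "\<And>n. S n \<in> T1" "eventually (\<lambda>n. S n \<in> V) sequentially"
    and lim: "\<And>x. (\<lambda>n. blinfun_apply (S n) x) \<longlonglongrightarrow> blinfun_apply T x"
  shows "T \<in> T1_top closure_of V"
  unfolding in_closure_of
proof (intro conjI allI impI)
  fix W assume W: "T \<in> W \<and> openin T1_top W"
  then obtain O' where O': "openin strong_operator_topology O'" "W = O' \<inter> T1"
    by (auto simp: openin_subtopology)
  then obtain G where G: "open G" "O' = blinfun_apply -` G"
    by (auto simp: strong_operator_topology_def openin_pullback_topology)
  have "limitin (product_topology (\<lambda>i. euclidean) UNIV) (\<lambda>n. blinfun_apply (S n)) (blinfun_apply T) sequentially"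
    unfolding limitin_componentwise using lim by simp
  then have "(\<lambda>n. blinfun_apply (S n)) \<longlonglongrightarrow> blinfun_apply T"
    by (simp add: euclidean_product_topology)
  moreover have "blinfun_apply T \<in> G" using W O' G by auto
  ultimately have "eventually (\<lambda>n. blinfun_apply (S n) \<in> G) sequentially"
    by (intro topological_tendstoD G(1))
  from eventually_conj[OF this S(2)] obtain n where "blinfun_apply (S n) \<in> G" "S n \<in> V"
    by (auto simp: eventually_sequentially)
  then show "\<exists>y. y \<in> V \<and> y \<in> W" using S(1) O' G by auto
qed (use T in simp)

text \<open>Membership in \<open>T1\<close> by matrix entries, for plain functions: perturbations
  are built as functions and become bounded operators afterwards through
  \<open>Blinfun\<close>.\<close>

definition subdiagonal :: "(complex ell2 \<Rightarrow> complex ell2) \<Rightarrow> bool" where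
  "subdiagonal t \<longleftrightarrow> contraction t \<and> (\<forall>j. (\<forall>k>Suc j. ell2_nth (t (basis_ell2 j)) k = 0) \<and>
     ell2_nth (t (basis_ell2 j)) (Suc j) \<in> \<real> \<and> Re (ell2_nth (t (basis_ell2 j)) (Suc j)) > 0)"

lemma norm_blinfun_le_one_iff: "norm T \<le> 1 \<longleftrightarrow> (\<forall>x. norm (blinfun_apply T x) \<le> norm x)"
proof
  assume "norm T \<le> 1"
  then show "\<forall>x. norm (blinfun_apply T x) \<le> norm x"
    using norm_blinfun[of T] by (meson mult_left_le_one_le norm_ge_zero order_trans)
qed (auto intro!: norm_blinfun_bound)

lemma T1_iff: "T \<in> T1 \<longleftrightarrow> subdiagonal (blinfun_apply T)"
  unfolding T1_def subdiagonal_def contractions_def contraction_def contraction_axioms_def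
    norm_blinfun_le_one_iff closure_span_basis cinner_basis by blast

lemma T1_contraction: "T \<in> T1 \<Longrightarrow> contraction (blinfun_apply T)"
  by (simp add: T1_iff subdiagonal_def)

lemma Blinfun_in_T1:
  assumes "subdiagonal t"
  shows "Blinfun t \<in> T1" and "blinfun_apply (Blinfun t) = t"
proof -
  show "blinfun_apply (Blinfun t) = t"
    using assms by (intro bounded_linear_Blinfun_apply contraction.bounded_linear) (simp add: subdiagonal_def)
  then show "Blinfun t \<in> T1" using assms by (simp add: T1_iff)
qed

section \<open>Density by scaling\<close>

definition shrink :: "(complex ell2 \<Rightarrow>\<^sub>L complex ell2) \<Rightarrow> nat \<Rightarrow> complex ell2 \<Rightarrow>\<^sub>L complex ell2" where
  "shrink T n = (1 - 1 / real (n + 2)) *\<^sub>R T"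

lemma norm_shrink_le:
  assumes "T \<in> T1"
  shows "norm (blinfun_apply (shrink T n) x) \<le> (1 - 1 / real (n + 2)) * norm x"
proof -
  have "0 \<le> 1 - 1 / real (n + 2)" by (simp add: field_simps)
  then show ?thesis
    using contraction.norm_le[OF T1_contraction[OF assms], of x]
    unfolding shrink_def blinfun.scaleR_left norm_scaleR
    by (simp only: abs_of_nonneg mult_left_mono)
qed

lemma shrink_in_T1:
  assumes "T \<in> T1"
  shows "shrink T n \<in> T1"
proof -
  interpret contraction "blinfun_apply T" by (rule T1_contraction[OF assms])
  \<comment> \<open>The offset 2 keeps the factor positive at \<open>n = 0\<close> too, and with it
    the subdiagonal entries.\<close>
  have r: "0 < 1 - 1 / real (n + 2)" by (simp add: field_simps)
  have "contraction (blinfun_apply (shrink T n))"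
  proof -
    have "norm (blinfun_apply (shrink T n) x) \<le> norm x" for x
      using norm_shrink_le[OF assms, of n x] mult_right_mono[of "1 - 1 / real (n + 2)" 1 "norm x"] by simp
    then show ?thesis
      by (auto simp: contraction_def contraction_axioms_def clinear_iff shrink_def blinfun.scaleR_left
          add scale scaleR_scaleC scaleC_add_right scaleC_scaleC mult.commute)
  qed
  then show ?thesis
    using assms r unfolding T1_iff subdiagonal_def
    by (auto simp: shrink_def blinfun.scaleR_left scaleR_conv_of_real intro!: Reals_mult mult_pos_pos)
qed

lemma shrink_tendsto: "(\<lambda>n. blinfun_apply (shrink T n) x) \<longlonglongrightarrow> blinfun_apply T x"
proof -
  have "(\<lambda>n. 1 - 1 / real (n + 2)) \<longlonglongrightarrow> 1 - 0"
    by (intro tendsto_intros LIMSEQ_ignore_initial_segment[OF lim_1_over_n])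
  then have "(\<lambda>n. (1 - 1 / real (n + 2)) *\<^sub>R blinfun_apply T x) \<longlonglongrightarrow> (1 - 0) *\<^sub>R blinfun_apply T x"
    by (intro tendsto_scaleR tendsto_const)
  then show ?thesis by (simp only: shrink_def blinfun.scaleR_left diff_zero scaleR_one)
qed

lemma dense_if_shrink:
  assumes "\<And>T n. T \<in> T1 \<Longrightarrow> shrink T n \<in> V" and "V \<subseteq> T1"
  shows "T1_top closure_of V = T1"
proof
  show "T1_top closure_of V \<subseteq> T1" using closure_of_subset_topspace[of T1_top V] by simp
  show "T1 \<subseteq> T1_top closure_of V"
  proof
    fix T assume "T \<in> T1"
    then show "T \<in> T1_top closure_of V"
      by (rule closure_of_T1_sequence[where S = "shrink T"])
        (simp_all add: \<open>T \<in> T1\<close> shrink_in_T1 assms(1) shrink_tendsto)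
  qed
qed

section \<open>Strong stability\<close>

definition stable_at :: "nat \<Rightarrow> real \<Rightarrow> (complex ell2 \<Rightarrow>\<^sub>L complex ell2) set" where
  "stable_at j e = {T \<in> T1. \<exists>n. norm ((blinfun_apply T ^^ n) (basis_ell2 j)) < e}"

text \<open>Composition is continuous here because contractions are uniformly bounded: the induction
  step splits the difference into \<open>T\<close> applied to the earlier error and the evaluation
  error at a fixed vector.\<close>

lemma continuous_map_funpow:
  "continuous_map T1_top euclidean (\<lambda>T. (blinfun_apply T ^^ n) x)"
proof (induction n)
  case (Suc n)
  show ?case
    unfolding continuous_map_atin limitin_canonical_iff
  proof
    fix S assume S: "S \<in> topspace T1_top"
    let ?p = "\<lambda>T. (blinfun_apply T ^^ n) x"
    have p: "(?p \<longlongrightarrow> ?p S) (atin T1_top S)"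
      using Suc.IH S unfolding continuous_map_atin limitin_canonical_iff by blast
    have q: "((\<lambda>T. blinfun_apply T (?p S)) \<longlongrightarrow> blinfun_apply S (?p S)) (atin T1_top S)"
      using continuous_map_evaluation[of "?p S"] S unfolding continuous_map_atin limitin_canonical_iff by blast
    have lim: "((\<lambda>T. norm (?p T - ?p S) + norm (blinfun_apply T (?p S) - blinfun_apply S (?p S))) \<longlongrightarrow> 0) (atin T1_top S)"
      by (intro tendsto_add_zero tendsto_norm_zero LIM_zero p q)
    have bound: "eventually (\<lambda>T. norm (blinfun_apply T (?p T) - blinfun_apply S (?p S)) \<le>
        norm (?p T - ?p S) + norm (blinfun_apply T (?p S) - blinfun_apply S (?p S))) (atin T1_top S)"
      unfolding eventually_atin
    proof (intro disjI2 exI[of _ "topspace T1_top"] conjI ballI S openin_topspace)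
      fix T assume "T \<in> topspace T1_top - {S}"
      then have "norm (blinfun_apply T (?p T - ?p S)) \<le> norm (?p T - ?p S)"
        using contraction.norm_le[OF T1_contraction] by simp
      moreover have "blinfun_apply T (?p T) - blinfun_apply S (?p S) =
          blinfun_apply T (?p T - ?p S) + (blinfun_apply T (?p S) - blinfun_apply S (?p S))"
        by (simp add: blinfun.diff_right)
      then have "norm (blinfun_apply T (?p T) - blinfun_apply S (?p S)) \<le>
          norm (blinfun_apply T (?p T - ?p S)) + norm (blinfun_apply T (?p S) - blinfun_apply S (?p S))"
        by (simp only: norm_triangle_ineq)
      ultimately show "norm (blinfun_apply T (?p T) - blinfun_apply S (?p S)) \<le>
          norm (?p T - ?p S) + norm (blinfun_apply T (?p S) - blinfun_apply S (?p S))"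
        by linarith
    qed
    from Lim_null_comparison[OF bound lim] show "((\<lambda>T. (blinfun_apply T ^^ Suc n) x) \<longlongrightarrow> (blinfun_apply S ^^ Suc n) x) (atin T1_top S)"
      unfolding funpow.simps(2) o_apply by (rule LIM_zero_cancel)
  qed
qed simp

lemma openin_stable_at: "openin T1_top (stable_at j e)"
proof -
  have "stable_at j e = (\<Union>n. {T \<in> T1. (blinfun_apply T ^^ n) (basis_ell2 j) \<in> ball 0 e})"
    by (auto simp: stable_at_def)
  also have "openin T1_top \<dots>"
    by (intro openin_Union) (auto simp del: mem_ball mem_ball_0 intro!: openin_T1_preimage continuous_map_funpow)
  finally show ?thesis .
qed

text \<open>The scaled operators have norm at most \<open>?r < 1\<close>, so their powers decay
  geometrically.\<close>

lemma dense_stable_at: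
  assumes "e > 0"
  shows "T1_top closure_of (stable_at j e) = T1"
proof (rule dense_if_shrink)
  fix T n assume T: "T \<in> T1"
  let ?r = "1 - 1 / real (n + 2)"
  have r: "0 \<le> ?r" "?r < 1" by (simp_all add: field_simps)
  have "norm ((blinfun_apply (shrink T n) ^^ k) (basis_ell2 j)) \<le> ?r ^ k" for k
  proof (induction k)
    case (Suc k)
    have "norm ((blinfun_apply (shrink T n) ^^ Suc k) (basis_ell2 j))
        \<le> ?r * norm ((blinfun_apply (shrink T n) ^^ k) (basis_ell2 j))"
      using norm_shrink_le[OF T] by simp
    also have "\<dots> \<le> ?r * ?r ^ k" by (intro mult_left_mono Suc.IH r)
    finally show ?case by simp
  qed simp
  moreover obtain k where "?r ^ k < e" using real_arch_pow_inv[OF assms r(2)] by blast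
  ultimately show "shrink T n \<in> stable_at j e"
    using shrink_in_T1[OF T] unfolding stable_at_def by (auto intro: le_less_trans)
qed (auto simp: stable_at_def)

section \<open>Strict contractivity on finitely many coordinates\<close>

definition strict_on :: "nat \<Rightarrow> (complex ell2 \<Rightarrow>\<^sub>L complex ell2) set" where
  "strict_on n = {T \<in> T1. \<exists>c<1. \<forall>v. trunc n v = v \<longrightarrow> norm (blinfun_apply T v) \<le> c * norm v}"

lemma dense_strict_on: "T1_top closure_of (strict_on n) = T1"
proof (rule dense_if_shrink)
  fix T m assume T: "T \<in> T1"
  have "1 - 1 / real (m + 2) < 1" by simp
  then show "shrink T m \<in> strict_on n"
    using shrink_in_T1[OF T] norm_shrink_le[OF T] unfolding strict_on_def by blast
qed (auto simp: strict_on_def)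

text \<open>One constant \<open>c < 1\<close> serves all vectors supported below \<open>n\<close>,
  so it stays below 1 for operators close to \<open>S\<close> on \<open>n\<close> basis vectors;
  these form a neighbourhood in the strong operator topology.\<close>

lemma openin_strict_on: "openin T1_top (strict_on n)"
  unfolding openin_subopen[of _ "strict_on n"]
proof
  fix S assume "S \<in> strict_on n"
  then obtain c where S: "S \<in> T1" and c: "c < 1"
    "\<And>v. trunc n v = v \<Longrightarrow> norm (blinfun_apply S v) \<le> c * norm v"
    by (auto simp: strict_on_def)
  \<comment> \<open>The errors on the \<open>n\<close> basis vectors add up to at most
    \<open>real n * h\<close>, which is less than \<open>1 - c\<close>; the denominator
    \<open>real n + 1\<close> also covers \<open>n = 0\<close>.\<close>
  define h where "h = (1 - c) / (real n + 1)"
  have h: "h > 0" "c + real n * h < 1" using c(1) by (simp_all add: h_def field_simps)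
  define G where "G = {T. \<forall>j\<in>{..<n}. blinfun_apply T (basis_ell2 j) \<in> ball (blinfun_apply S (basis_ell2 j)) h}"
  have "openin strong_operator_topology G"
    unfolding G_def by (rule strong_operator_topology_basis) auto
  then have "openin T1_top (T1 \<inter> G)" by (rule openin_subtopology_Int2)
  moreover have "S \<in> T1 \<inter> G" using S h(1) by (simp add: G_def)
  moreover have "T1 \<inter> G \<subseteq> strict_on n"
  proof
    fix T assume T: "T \<in> T1 \<inter> G"
    interpret D: Vector_Spaces.linear scaleC scaleC "\<lambda>x. blinfun_apply T x - blinfun_apply S x"
      using T1_contraction[of T] T1_contraction[OF S] T
      by (auto simp: contraction_def clinear_iff scaleC.scale_right_diff_distrib)
    have "norm (blinfun_apply T v) \<le> (c + real n * h) * norm v" if v: "trunc n v = v" for v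
    proof -
      have "norm (blinfun_apply T (trunc n v) - blinfun_apply S (trunc n v))
          \<le> (\<Sum>j<n. norm (ell2_nth v j *\<^sub>C (blinfun_apply T (basis_ell2 j) - blinfun_apply S (basis_ell2 j))))"
        unfolding trunc_def D.sum D.scale by (rule norm_sum)
      also have "\<dots> \<le> (\<Sum>j<n. norm v * h)"
      proof (rule sum_mono)
        fix j assume "j \<in> {..<n}"
        then have "norm (blinfun_apply T (basis_ell2 j) - blinfun_apply S (basis_ell2 j)) \<le> h"
          using T by (auto simp: G_def dist_norm norm_minus_commute intro: less_imp_le)
        then show "norm (ell2_nth v j *\<^sub>C (blinfun_apply T (basis_ell2 j) - blinfun_apply S (basis_ell2 j))) \<le> norm v * h"
          unfolding norm_scaleC by (intro mult_mono norm_ell2_nth_le) auto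
      qed
      finally have "norm (blinfun_apply T v - blinfun_apply S v) \<le> real n * (norm v * h)"
        by (simp add: v)
      then show ?thesis
        using c(2)[OF v] norm_triangle_sub[of "blinfun_apply T v" "blinfun_apply S v"]
        by (simp add: algebra_simps)
    qed
    then show "T \<in> strict_on n" using T h(2) by (auto simp: strict_on_def)
  qed
  ultimately show "\<exists>G. openin T1_top G \<and> S \<in> G \<and> G \<subseteq> strict_on n" by blast
qed

section \<open>Approximate preimages of basis vectors\<close>

definition onto_at :: "nat \<Rightarrow> real \<Rightarrow> (complex ell2 \<Rightarrow>\<^sub>L complex ell2) set" where
  "onto_at i e = {T \<in> T1. \<exists>x. norm x \<le> 1 \<and> norm (blinfun_apply T x - basis_ell2 i) < e}"

lemma openin_onto_at: "openin T1_top (onto_at i e)"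
proof -
  have "onto_at i e = (\<Union>x\<in>cball 0 1. {T \<in> T1. blinfun_apply T x \<in> ball (basis_ell2 i) e})"
    by (auto simp: onto_at_def dist_norm norm_minus_commute intro!: bexI)
  also have "openin T1_top \<dots>"
    by (intro openin_Union) (auto simp del: mem_ball mem_ball_0 intro!: openin_T1_preimage continuous_map_evaluation)
  finally show ?thesis .
qed

lift_definition forward_shift :: "'a::real_inner ell2 \<Rightarrow> 'a ell2"
  is "\<lambda>x n. case n of 0 \<Rightarrow> 0 | Suc k \<Rightarrow> x k"
  by (subst summable_Suc_iff[symmetric]) simp

lemma norm_forward_shift: "norm (forward_shift x) = norm x"
proof -
  have "(\<lambda>n. (norm (ell2_nth (forward_shift x) (Suc n)))\<^sup>2) sums (norm x)\<^sup>2"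
    using norm_ell2_sums[of x] by (simp add: forward_shift.rep_eq)
  then have "(\<lambda>n. (norm (ell2_nth (forward_shift x) n))\<^sup>2) sums (norm x)\<^sup>2"
    by (subst (asm) sums_Suc_iff) (simp add: forward_shift.rep_eq)
  then have "(norm (forward_shift x))\<^sup>2 = (norm x)\<^sup>2"
    using norm_ell2_sums sums_unique2 by blast
  then show ?thesis by simp
qed

lemma clinear_forward_shift: "Vector_Spaces.linear scaleC scaleC forward_shift"
  by (auto simp: clinear_iff forward_shift.rep_eq split: nat.splits intro!: ell2_eqI)

text \<open>\<open>S\<close> mixes \<open>B\<close> and \<open>R\<close> with weights
  \<open>1 - \<eta>\<close> and \<open>\<eta>\<close>. \<open>B\<close> agrees with \<open>T\<close>
  on the first \<open>N\<close> basis vectors and reaches \<open>basis_ell2 i\<close> exactly from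
  the unit ball; \<open>R\<close> supplies the positive subdiagonal in the columns from
  \<open>N\<close> on.\<close>

lemma subdiagonal_perturbation:
  assumes T: "subdiagonal T" and eta: "0 < \<eta>" "\<eta> < 1"
  obtains S where "subdiagonal S"
    "\<And>x. norm (S x - T x) \<le> 2 * norm (x - trunc N x) + 2 * \<eta> * norm x"
    "\<exists>x. norm x \<le> 1 \<and> norm (S x - basis_ell2 i) \<le> 2 * \<eta>"
proof -
  interpret T: contraction T using T by (simp add: subdiagonal_def)
  interpret P: Vector_Spaces.linear scaleC scaleC "trunc N" by (rule clinear_trunc)
  interpret F: Vector_Spaces.linear scaleC scaleC forward_shift by (rule clinear_forward_shift)
  define A where "A x = T (trunc N x)" for x
  interpret A: contraction A
    by (auto simp: contraction_def contraction_axioms_def clinear_iff A_def P.add P.scale T.add T.scale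
        intro: order_trans[OF T.norm_le norm_trunc_le])
  define y where "y = basis_ell2 i"
  obtain w t where wt: "\<And>u s. (norm (A u + s *\<^sub>C w))\<^sup>2 \<le> (norm u)\<^sup>2 + (cmod s)\<^sup>2"
    "A (adj A y) + t *\<^sub>C w = y" "(norm (adj A y))\<^sup>2 + (cmod t)\<^sup>2 = (norm y)\<^sup>2"
    "\<exists>r. w = r *\<^sub>C (y - A (adj A y))"
    using A.one_dimensional_extension by blast
  have trunc_basis: "trunc N (basis_ell2 j) = (if j < N then basis_ell2 j else 0)" for j
    by (auto simp: ell2_nth_trunc ell2_nth_basis intro!: ell2_eqI)
  \<comment> \<open>\<open>A\<close> vanishes on \<open>basis_ell2 M\<close> because
    \<open>M\<close> exceeds \<open>N\<close>. As \<open>M\<close> exceeds \<open>i\<close> too,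
    \<open>w\<close> has no coordinates from \<open>M\<close> on, so placing \<open>w\<close> in
    column \<open>M\<close> leaves the subdiagonal entry of that column to \<open>R\<close>.\<close>
  define M where "M = N + i + 1"
  have A_trunc: "A (trunc N x) = A x" for x
    by (simp add: A_def ell2_nth_trunc ell2_eqI[of "trunc N (trunc N x)" "trunc N x"])
  have A_nth: "ell2_nth (A x) k = 0" if "k > N" for x k
  proof -
    have "ell2_nth (T (basis_ell2 j)) k = 0" if "j < N" for j
      using T that \<open>k > N\<close> by (simp add: subdiagonal_def)
    then show ?thesis
      by (simp add: A_def trunc_def T.sum T.scale ell2_nth_sum)
  qed
  have w_nth: "ell2_nth w k = 0" if "k \<ge> M" for k
    using wt(4) that by (auto simp: A_nth y_def ell2_nth_basis M_def)
  have norm_w: "norm w \<le> 1"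
    using wt(1)[of 0 1] by (simp add: scaleC_one A.zero abs_square_le_1)
  define B where "B x = A x + ell2_nth x M *\<^sub>C w" for x
  \<comment> \<open>The shift acts only on the tail, so the first \<open>N\<close> columns keep the
    subdiagonal entries of \<open>T\<close> up to the factor \<open>1 - \<eta>\<close>.\<close>
  define R where "R x = forward_shift (x - trunc N x)" for x
  have norm_R: "norm (R x) \<le> norm x" for x
    by (simp add: R_def norm_forward_shift norm_diff_trunc_le)
  have nth_M: "norm (ell2_nth x M) \<le> norm (x - trunc N x)" for x
    using norm_ell2_nth_le[of "x - trunc N x" M] by (simp add: ell2_nth_trunc M_def)
  have norm_B: "norm (B x) \<le> norm x" for x
  proof (rule power2_le_imp_le)
    \<comment> \<open>The extension bound is applied to the truncation; with \<open>x\<close> itself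
      the coordinate at \<open>M\<close> would be counted twice.\<close>
    have "(norm (B x))\<^sup>2 \<le> (norm (trunc N x))\<^sup>2 + (norm (ell2_nth x M))\<^sup>2"
      using wt(1)[of "trunc N x" "ell2_nth x M"] by (simp add: B_def A_trunc)
    also have "\<dots> \<le> (norm (trunc N x))\<^sup>2 + (norm (x - trunc N x))\<^sup>2"
      by (intro add_left_mono power_mono nth_M norm_ge_zero)
    finally show "(norm (B x))\<^sup>2 \<le> (norm x)\<^sup>2"
      using norm_trunc_decomp[of x N] by simp
  qed simp
  define S where "S x = (1 - \<eta>) *\<^sub>R B x + \<eta> *\<^sub>R R x" for x
  have nS: "norm (S x) \<le> norm x" for x
  proof -
    have "norm (S x) \<le> (1 - \<eta>) * norm (B x) + \<eta> * norm (R x)"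
      unfolding S_def using eta norm_triangle_ineq[of "(1 - \<eta>) *\<^sub>R B x" "\<eta> *\<^sub>R R x"] by simp
    also have "\<dots> \<le> (1 - \<eta>) * norm x + \<eta> * norm x"
      using eta by (intro add_mono mult_left_mono norm_B norm_R) auto
    finally show ?thesis by (simp add: algebra_simps)
  qed
  have lin: "Vector_Spaces.linear scaleC scaleC S"
    by (auto simp: clinear_iff S_def B_def R_def A.add A.scale P.add P.scale F.add F.scale F.diff
        scaleR_scaleC scaleC_add_right scaleC_add_left scaleC_scaleC scaleC.scale_right_diff_distrib
        algebra_simps)
  have contr: "contraction S"
    using lin nS by (simp add: contraction_def contraction_axioms_def)
  have R_basis: "ell2_nth (R (basis_ell2 j)) k = (if N \<le> j \<and> k = Suc j then 1 else 0)" for j k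
    by (auto simp: R_def trunc_basis forward_shift.rep_eq ell2_nth_basis split: nat.splits)
  have S_nth: "ell2_nth (S (basis_ell2 j)) k = (1 - \<eta>) *\<^sub>R (ell2_nth (A (basis_ell2 j)) k +
      (if M = j then ell2_nth w k else 0)) + (if N \<le> j \<and> k = Suc j then \<eta> else 0)" for j k
    by (auto simp: S_def B_def R_basis ell2_nth_basis scaleR_conv_of_real)
  have "subdiagonal S"
    unfolding subdiagonal_def
  proof (rule conjI[OF contr], rule allI)
    fix j
    show "(\<forall>k>Suc j. ell2_nth (S (basis_ell2 j)) k = 0) \<and>
     ell2_nth (S (basis_ell2 j)) (Suc j) \<in> \<real> \<and> Re (ell2_nth (S (basis_ell2 j)) (Suc j)) > 0"
    proof (cases "j < N")
      case True
      then have "A (basis_ell2 j) = T (basis_ell2 j)" "M \<noteq> j"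
        by (simp_all add: A_def trunc_basis M_def)
      then show ?thesis
        using T True eta by (auto simp: S_nth subdiagonal_def scaleR_conv_of_real intro!: Reals_mult)
    next
      case False
      then have "A (basis_ell2 j) = 0" by (simp add: A_def trunc_basis T.zero)
      then show ?thesis
        using False eta by (auto simp: S_nth w_nth)
    qed
  qed
  moreover have "norm (S x - T x) \<le> 2 * norm (x - trunc N x) + 2 * \<eta> * norm x" for x
  proof -
    \<comment> \<open>Replacing \<open>T\<close> by \<open>B\<close> costs the tail twice, through
      column \<open>M\<close> and through the cut; mixing costs at most
      \<open>2 * \<eta> * norm x\<close>.\<close>
    have "S x - T x = ell2_nth x M *\<^sub>C w - T (x - trunc N x) + (\<eta> *\<^sub>R R x - \<eta> *\<^sub>R B x)"
      by (simp add: S_def B_def A_def T.diff algebra_simps)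
    also have "norm \<dots> \<le> (norm (ell2_nth x M *\<^sub>C w) + norm (T (x - trunc N x))) +
        (norm (\<eta> *\<^sub>R R x) + norm (\<eta> *\<^sub>R B x))"
      by (intro norm_triangle_le add_mono norm_triangle_ineq4)
    also have "\<dots> \<le> (norm (x - trunc N x) * 1 + norm (x - trunc N x)) + (\<eta> * norm x + \<eta> * norm x)"
      using eta unfolding norm_scaleC norm_scaleR
      by (intro add_mono mult_mono nth_M norm_w T.norm_le norm_R norm_B) auto
    finally show ?thesis by simp
  qed
  moreover have "\<exists>x. norm x \<le> 1 \<and> norm (S x - basis_ell2 i) \<le> 2 * \<eta>"
  proof (intro exI conjI)
    define a where "a = adj A y"
    \<comment> \<open>\<open>a\<close> is supported below \<open>N\<close>, hence orthogonal to
      \<open>basis_ell2 M\<close>; by the choice of \<open>t\<close> and \<open>w\<close>, the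
      vector \<open>x\<close> has norm 1 and \<open>B x = y\<close>. So \<open>S x\<close> misses
      \<open>y\<close> only by \<open>\<eta>\<close> times \<open>R x - y\<close>.\<close>
    define x where "x = a + t *\<^sub>C basis_ell2 M"
    have a_nth: "ell2_nth a k = 0" if "k \<ge> N" for k
      using that by (simp add: a_def A.ell2_nth_adj A_def trunc_basis T.zero)
    have "cinner a (t *\<^sub>C basis_ell2 M) = 0"
      by (simp add: cinner_scaleC_right cinner_basis a_nth M_def)
    from norm_add_orthogonal[OF this] have "(norm x)\<^sup>2 = 1"
      using wt(3) by (simp add: x_def norm_scaleC a_def y_def)
    then show x: "norm x \<le> 1" by (auto simp: power2_eq_1_iff)
    have "A (basis_ell2 M) = 0" by (simp add: A_def trunc_basis T.zero M_def)
    moreover have "ell2_nth a M = 0" by (simp add: a_nth M_def)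
    ultimately have "B x = y"
      using wt(2) by (simp add: B_def x_def A.add A.scale ell2_nth_basis flip: a_def)
    then have "S x - basis_ell2 i = \<eta> *\<^sub>R (R x - y)"
      by (simp add: S_def y_def algebra_simps)
    moreover have "norm (R x - y) \<le> 2"
      using norm_triangle_ineq4[of "R x" y] norm_R[of x] x by (simp add: y_def)
    ultimately show "norm (S x - basis_ell2 i) \<le> 2 * \<eta>" using eta by simp
  qed
  ultimately show ?thesis by (rule that)
qed

text \<open>Perturb with cut-off \<open>n\<close> and weight \<open>1 / real (n + 2)\<close>: at
  each \<open>x\<close> the error is bounded by a tail of \<open>x\<close> plus a null sequence, and
  the approximate preimages eventually come within \<open>e\<close>.\<close>

lemma dense_onto_at:
  assumes "e > 0"
  shows "T1_top closure_of (onto_at i e) = T1"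
proof
  show "T1_top closure_of (onto_at i e) \<subseteq> T1"
    using closure_of_subset_topspace[of T1_top] by simp
  show "T1 \<subseteq> T1_top closure_of (onto_at i e)"
  proof
    fix T assume T: "T \<in> T1"
    define eta where "eta n = 1 / real (n + 2)" for n
    have eta: "0 < eta n" "eta n < 1" for n by (simp_all add: eta_def)
    have eta_lim: "eta \<longlonglongrightarrow> 0"
      unfolding eta_def by (rule LIMSEQ_ignore_initial_segment[OF lim_1_over_n])
    have "\<exists>S. subdiagonal S \<and>
      (\<forall>x. norm (S x - blinfun_apply T x) \<le> 2 * norm (x - trunc n x) + 2 * eta n * norm x) \<and>
      (\<exists>x. norm x \<le> 1 \<and> norm (S x - basis_ell2 i) \<le> 2 * eta n)" for n
      using subdiagonal_perturbation[of "blinfun_apply T" "eta n" n i] eta[of n] T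
      unfolding T1_iff by metis
    then obtain S where S: "\<And>n. subdiagonal (S n)"
      "\<And>n x. norm (S n x - blinfun_apply T x) \<le> 2 * norm (x - trunc n x) + 2 * eta n * norm x"
      "\<And>n. \<exists>x. norm x \<le> 1 \<and> norm (S n x - basis_ell2 i) \<le> 2 * eta n"
      by metis
    show "T \<in> T1_top closure_of (onto_at i e)"
    proof (rule closure_of_T1_sequence[OF T, where S = "\<lambda>n. Blinfun (S n)"])
      show "Blinfun (S n) \<in> T1" for n by (rule Blinfun_in_T1(1)[OF S(1)])
      have "eventually (\<lambda>n. eta n < e / 2) sequentially"
        using order_tendstoD(2)[OF eta_lim, of "e / 2"] assms by simp
      then show "eventually (\<lambda>n. Blinfun (S n) \<in> onto_at i e) sequentially"
      proof (rule eventually_mono)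
        fix n assume "eta n < e / 2"
        moreover obtain x where "norm x \<le> 1" "norm (S n x - basis_ell2 i) \<le> 2 * eta n"
          using S(3) by blast
        ultimately show "Blinfun (S n) \<in> onto_at i e"
          using Blinfun_in_T1[OF S(1)[of n]] unfolding onto_at_def
          by (auto intro!: exI[of _ x])
      qed
      fix x
      have "(\<lambda>n. 2 * norm (x - trunc n x) + 2 * eta n * norm x) \<longlonglongrightarrow> 2 * norm (x - x) + 2 * 0 * norm x"
        by (intro tendsto_intros trunc_tendsto eta_lim)
      then have lim: "(\<lambda>n. 2 * norm (x - trunc n x) + 2 * eta n * norm x) \<longlonglongrightarrow> 0" by simp
      have "(\<lambda>n. S n x - blinfun_apply T x) \<longlonglongrightarrow> 0"
        by (rule Lim_null_comparison[OF always_eventually lim]) (simp add: S(2))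
      then show "(\<lambda>n. blinfun_apply (Blinfun (S n)) x) \<longlonglongrightarrow> blinfun_apply T x"
        unfolding Blinfun_in_T1(2)[OF S(1)] by (rule LIM_zero_cancel)
    qed
  qed
qed

theorem theorem2p4:
  shows "typical_in (subtopology strong_operator_topology T1)
           (\<lambda>T. unitarily_equivalent (blinfun_apply T)
                  (backward_shift :: complex ell2 ell2 \<Rightarrow> complex ell2 ell2))
       \<and> typical_in (subtopology strong_operator_topology T1)
           (\<lambda>T. \<exists>c. eigenvalue (blinfun_apply T) c)
       \<and> typical_in (subtopology strong_operator_topology T1)
           (\<lambda>T. \<exists>E. nontrivial_invariant_subspace (blinfun_apply T) E)"
proof -
  define e where "e k = 1 / real (Suc k)" for k
  have e: "e k > 0" for k by (simp add: e_def)
  \<comment> \<open>\<open>k\<close> has two roles: it sets the tolerance \<open>e k\<close> in the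
    first two conditions and is the number of coordinates in the third.\<close>
  define \<O> where "\<O> = (\<Union>j k. {stable_at j (e k), onto_at j (e k), strict_on k})"
  have "countable \<O>" "\<O> \<noteq> {}" by (auto simp: \<O>_def)
  moreover have "openin T1_top V" "T1_top closure_of V = topspace T1_top" if "V \<in> \<O>" for V
    using that e by (auto simp: \<O>_def openin_stable_at openin_onto_at openin_strict_on
        dense_stable_at dense_onto_at dense_strict_on)
  ultimately have typical: "typical_in T1_top P"
    if "\<And>T. T \<in> T1 \<Longrightarrow> (\<And>V. V \<in> \<O> \<Longrightarrow> T \<in> V) \<Longrightarrow> P T" for P
    by (rule typical_inI) (use that in simp_all)
  have model: "stable_coisometry (blinfun_apply T)"
    and strict: "\<And>n v. v \<noteq> 0 \<Longrightarrow> trunc n v = v \<Longrightarrow> norm (blinfun_apply T v) < norm v"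
    if T: "T \<in> T1" and V: "\<And>V. V \<in> \<O> \<Longrightarrow> T \<in> V" for T
  proof -
    interpret contraction "blinfun_apply T" by (rule T1_contraction[OF T])
    have *: "\<exists>k. e k < r" if "r > 0" for r
      using nat_approx_posE[OF that] unfolding e_def by metis
    have "\<exists>n. norm ((blinfun_apply T ^^ n) (basis_ell2 j)) < r" if "r > 0" for j r
    proof -
      obtain k where k: "e k < r" using *[OF \<open>r > 0\<close>] by blast
      have "T \<in> stable_at j (e k)" by (rule V) (auto simp: \<O>_def)
      then show ?thesis using k by (auto simp: stable_at_def intro: less_trans)
    qed
    then have "(\<lambda>n. (blinfun_apply T ^^ n) x) \<longlonglongrightarrow> 0" for x by (rule funpow_tendsto_zero)
    moreover have "\<exists>x. norm x \<le> 1 \<and> norm (blinfun_apply T x - basis_ell2 j) < r" if "r > 0" for j r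
    proof -
      obtain k where k: "e k < r" using *[OF \<open>r > 0\<close>] by blast
      have "T \<in> onto_at j (e k)" by (rule V) (auto simp: \<O>_def)
      then show ?thesis using k by (auto simp: onto_at_def intro: less_trans)
    qed
    then have "blinfun_apply T (adj (blinfun_apply T) y) = y" for y by (rule T_adj_eqI)
    ultimately show "stable_coisometry (blinfun_apply T)" by unfold_locales
    fix n :: nat and v :: "complex ell2" assume v: "v \<noteq> 0" "trunc n v = v"
    have "T \<in> strict_on n" by (rule V) (auto simp: \<O>_def)
    then obtain c where "c < 1" "norm (blinfun_apply T v) \<le> c * norm v"
      using v(2) by (auto simp: strict_on_def)
    then show "norm (blinfun_apply T v) < norm v"
      using v(1) mult_strict_right_mono[of c 1 "norm v"] by (auto intro: le_less_trans)
  qed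
  have kernel: "\<exists>x. x \<noteq> 0 \<and> blinfun_apply T x = 0"
    if T: "T \<in> T1" and V: "\<And>V. V \<in> \<O> \<Longrightarrow> T \<in> V" for T
  proof -
    interpret stable_coisometry "blinfun_apply T" by (rule model[OF T V])
    \<comment> \<open>\<open>basis_ell2 0\<close> is supported below 1, so strictness gives it a
      nonzero component \<open>Q (basis_ell2 0)\<close> in the kernel.\<close>
    have "norm (blinfun_apply T (basis_ell2 0)) < norm (basis_ell2 0)"
      by (rule strict[OF T V, of _ 1])
        (auto simp: ell2_nth_trunc ell2_nth_basis intro!: ell2_eqI dest: arg_cong[of "basis_ell2 0" 0 norm])
    then have "(norm (blinfun_apply T (basis_ell2 0)))\<^sup>2 < (norm (basis_ell2 0))\<^sup>2"
      by (intro power_strict_mono) auto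
    then have "Q (basis_ell2 0) \<noteq> 0"
      using norm_Q_T[of "basis_ell2 0"] by auto
    then show ?thesis using T_Q by blast
  qed
  have "nontrivial_invariant_subspace (blinfun_apply T) {x. blinfun_apply T x = 0}"
    if T: "T \<in> T1" and V: "\<And>V. V \<in> \<O> \<Longrightarrow> T \<in> V" for T
    unfolding nontrivial_invariant_subspace_def
  proof (intro conjI)
    interpret contraction "blinfun_apply T" by (rule T1_contraction[OF T])
    show "scaleC.subspace {x. blinfun_apply T x = 0}" by (rule subspace_kernel)
    show "closed {x. blinfun_apply T x = 0}"
      by (intro closed_Collect_eq continuous_intros)
    show "{x. blinfun_apply T x = 0} \<noteq> {0}" using kernel[OF T V] by blast
    \<comment> \<open>The first subdiagonal entry is positive, so the kernel is a proper
      subspace.\<close>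
    have "blinfun_apply T (basis_ell2 0) \<noteq> 0"
      using T by (auto simp: T1_iff subdiagonal_def dest!: spec[of _ 0])
    then show "{x. blinfun_apply T x = 0} \<noteq> UNIV" by blast
    show "blinfun_apply T ` {x. blinfun_apply T x = 0} \<subseteq> {x. blinfun_apply T x = 0}" by auto
  qed
  moreover have "eigenvalue (blinfun_apply T) 0"
    if T: "T \<in> T1" and V: "\<And>V. V \<in> \<O> \<Longrightarrow> T \<in> V" for T
    using kernel[OF T V] by (simp add: eigenvalue_def)
  moreover have "unitarily_equivalent (blinfun_apply T) (backward_shift :: complex ell2 ell2 \<Rightarrow> complex ell2 ell2)"
    if T: "T \<in> T1" and V: "\<And>V. V \<in> \<O> \<Longrightarrow> T \<in> V" for T
    by (rule stable_coisometry.unitarily_equivalent_shift[OF model[OF T V] strict[OF T V]])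
  ultimately show ?thesis by (intro conjI typical) blast+
qed

end
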